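(* Let $X,Y$ be real Banach spaces and let $F(x)=\sum_{m=0}^\infty P_m(x)$ be a power series centered at $0$, where each $P_m=\widehat{L}_m:X\to Y$ is a continuous $m$-homogeneous polynomial ($L_m$ continuous symmetric $m$-linear). Let $\rho=1/\limsup_{m\to\infty}\|P_m\|^{1/m}>0$ be its radius of uniform convergence and $\rho_A$ its radius of analyticity. Then: (i) $\rho_A\ge \rho/\sqrt{2}$; (ii) for every $n\ge1$, the $n$th Fréchet derivative $D^nF$, viewed as a map from $X$ into the Banach space $\mathcal{L}_n(X,Y)$ of continuous $n$-linear maps $X^n\to Y$, has a Taylor series centered at the origin, namely $T_0D^nF(x)=n!\sum_{m=0}^\infty\binom{m+n}{n}L_{m+n}(x^m,\cdot)$, whose radius of uniform convergence is at least $\rho/\sqrt{2}$ for $n=2$ and at least $\rho/\sqrt{e}$ for $n\ge3$; (iii) for every $n$, the radius of analyticity of the power series $D^nF(x)$ is at least $\rho/\sqrt2$.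
   Context: A power series centered at $a\in X$ is a formal sum $\sum_{m\ge0}P_m(x-a)$ with $P_m:X\to Y$ continuous $m$-homogeneous polynomials (i.e. $P_m(x)=L_m(x,\ldots,x)$ for a continuous symmetric $m$-linear $L_m$), $\|P_m\|=\sup_{\|x\|\le1}\|P_m(x)\|$. Its radius of uniform convergence is the supremum of $r$ such that the series converges uniformly on $\{\|x-a\|\le r\}$; it equals $1/\limsup_m\|P_m\|^{1/m}$. For an infinitely (Fréchet) differentiable $F$ near $a$, its Taylor series at $a$ is $T_aF(x)=\sum_{m\ge0}\frac{1}{m!}D^mF(a)((x-a)^m)$. $F$ is analytic at $a$ if $T_aF$ has positive radius of uniform convergence and equals $F$ on its domain of uniform convergence. $F$ is fully analytic in an open set $U$ if it is analytic at every $a\in U$ and, for each $a\in U$, $T_aF$ converges uniformly on every closed ball centered at $a$ contained in $U$. The radius of analyticity $\rho_A$ of a power series $F$ centered at $a$ (with positive radius of uniform convergence) is the largest $r>0$ such that $F$ is fully analytic in the open ball $B_r(a)$. *)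

theory Defs
  imports "HOL-Analysis.Analysis"
begin

text \<open>
  Continuous p-linear maps X^p -> Y are encoded as functions
  T :: (nat => 'a) => 'b taking a tuple v (only the slots 0..p-1 matter).
  The Banach space L_p(X,Y) is the set of such T with bml p T, normed by mnorm p.
  A map G : X -> L_p(X,Y) is a function 'a => (nat => 'a) => 'b.
  Y itself is identified with L_0(X,Y).
\<close>

definition bml :: "nat \<Rightarrow> ((nat \<Rightarrow> 'a::real_normed_vector) \<Rightarrow> 'b::real_normed_vector) \<Rightarrow> bool" where
  "bml p T \<longleftrightarrow>
     (\<forall>v w. (\<forall>i<p. v i = w i) \<longrightarrow> T v = T w) \<and>
     (\<forall>i<p. \<forall>v. linear (\<lambda>y. T (v(i := y)))) \<and>
     (\<exists>C. \<forall>v. norm (T v) \<le> C * (\<Prod>i<p. norm (v i)))"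

definition msym :: "nat \<Rightarrow> ((nat \<Rightarrow> 'a) \<Rightarrow> 'b) \<Rightarrow> bool" where
  "msym p T \<longleftrightarrow> (\<forall>\<sigma> v. \<sigma> permutes {..<p} \<longrightarrow> T (v \<circ> \<sigma>) = T v)"

definition mnorm :: "nat \<Rightarrow> ((nat \<Rightarrow> 'a::real_normed_vector) \<Rightarrow> 'b::real_normed_vector) \<Rightarrow> real" where
  "mnorm p T = Sup {norm (T v) | v. \<forall>i<p. norm (v i) \<le> 1}"

definition tcons :: "'a \<Rightarrow> (nat \<Rightarrow> 'a) \<Rightarrow> nat \<Rightarrow> 'a" where
  "tcons h v = (\<lambda>i. if i = 0 then h else v (i - 1))"

text \<open>Frechet derivative of H : X -> L_p(X,Y) at x is H' in L_(p+1)(X,Y) = L(X, L_p(X,Y)),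
  with the new direction in slot 0.\<close>
definition mfderiv :: "nat \<Rightarrow> ('a::real_normed_vector \<Rightarrow> (nat \<Rightarrow> 'a) \<Rightarrow> 'b::real_normed_vector)
    \<Rightarrow> ((nat \<Rightarrow> 'a) \<Rightarrow> 'b) \<Rightarrow> 'a \<Rightarrow> bool" where
  "mfderiv p H H' x \<longleftrightarrow> bml (Suc p) H' \<and>
     ((\<lambda>h. mnorm p (\<lambda>v. H (x + h) v - H x v - H' (tcons h v)) / norm h) \<longlongrightarrow> 0) (at 0)"

text \<open>D k is the k-th Frechet derivative of G : X -> L_p(X,Y) on the open set U
  (so D k x \<in> L_(p+k)(X,Y), the k derivative directions in the first k slots).\<close>
definition dtower :: "nat \<Rightarrow> 'a set \<Rightarrow> ('a::real_normed_vector \<Rightarrow> (nat \<Rightarrow> 'a) \<Rightarrow> 'b::real_normed_vector)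
    \<Rightarrow> (nat \<Rightarrow> 'a \<Rightarrow> (nat \<Rightarrow> 'a) \<Rightarrow> 'b) \<Rightarrow> bool" where
  "dtower p U G D \<longleftrightarrow> open U \<and> (\<forall>x\<in>U. D 0 x = G x) \<and>
     (\<forall>k. \<forall>x\<in>U. bml (p + k) (D k x) \<and> mfderiv (p + k) (D k) (D (Suc k) x) x)"

definition uconv :: "nat \<Rightarrow> 'a set \<Rightarrow> (nat \<Rightarrow> 'a::real_normed_vector \<Rightarrow> (nat \<Rightarrow> 'a) \<Rightarrow> 'b::real_normed_vector) \<Rightarrow> bool" where
  "uconv p S Q \<longleftrightarrow> (\<exists>Gl. (\<forall>x\<in>S. bml p (Gl x)) \<and>
     (\<forall>\<epsilon>>0. \<exists>N. \<forall>M\<ge>N. \<forall>x\<in>S. mnorm p (\<lambda>v. (\<Sum>m<M. Q m x v) - Gl x v) < \<epsilon>))"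

text \<open>radius of uniform convergence of a power series centered at a (terms Q m x = P_m(x - a))\<close>
definition urad :: "nat \<Rightarrow> 'a \<Rightarrow> (nat \<Rightarrow> 'a::real_normed_vector \<Rightarrow> (nat \<Rightarrow> 'a) \<Rightarrow> 'b::real_normed_vector) \<Rightarrow> ereal" where
  "urad p a Q = Sup {ereal r | r. 0 \<le> r \<and> uconv p (cball a r) Q}"

definition udom :: "nat \<Rightarrow> 'a \<Rightarrow> (nat \<Rightarrow> 'a::real_normed_vector \<Rightarrow> (nat \<Rightarrow> 'a) \<Rightarrow> 'b::real_normed_vector) \<Rightarrow> 'a set" where
  "udom p a Q = \<Union> {cball a r | r. 0 \<le> r \<and> uconv p (cball a r) Q}"

definition tterm :: "(nat \<Rightarrow> 'a \<Rightarrow> (nat \<Rightarrow> 'a) \<Rightarrow> 'b) \<Rightarrow> 'a \<Rightarrow> nat \<Rightarrow> 'a::real_normed_vector \<Rightarrow> (nat \<Rightarrow> 'a) \<Rightarrow> 'b::real_normed_vector" where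
  "tterm D a m x = (\<lambda>v. (1 / fact m) *\<^sub>R D m a (\<lambda>i. if i < m then x - a else v (i - m)))"

definition fully_analytic :: "nat \<Rightarrow> 'a set \<Rightarrow> ('a::real_normed_vector \<Rightarrow> (nat \<Rightarrow> 'a) \<Rightarrow> 'b::real_normed_vector) \<Rightarrow> bool" where
  "fully_analytic p U G \<longleftrightarrow> (\<exists>D. dtower p U G D \<and>
     (\<forall>a\<in>U. urad p a (tterm D a) > 0 \<and>
        (\<forall>x \<in> udom p a (tterm D a) \<inter> U. \<forall>v. (\<lambda>m. tterm D a m x v) sums G x v) \<and>
        (\<forall>r. cball a r \<subseteq> U \<longrightarrow> uconv p (cball a r) (tterm D a))))"

definition arad :: "nat \<Rightarrow> 'a \<Rightarrow> ('a::real_normed_vector \<Rightarrow> (nat \<Rightarrow> 'a) \<Rightarrow> 'b::real_normed_vector) \<Rightarrow> ereal" where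
  "arad p a G = Sup {ereal r | r. 0 < r \<and> fully_analytic p (ball a r) G}"

end

theory Submission
  imports Defs
begin

text \<open>
  Banach's theorem says that on a Euclidean space a symmetric multilinear map has the same norm
  as its polynomial. Pulling \<open>L\<^sub>m\<close> back along \<open>(s, t) \<mapsto> s x + t y\<close> with \<open>\<bar>s\<bar> + \<bar>t\<bar> \<le> sqrt 2 * sqrt (s\<^sup>2 + t\<^sup>2)\<close>
  gives \<open>\<parallel>L\<^sub>m(x\<^sup>m\<^sup>-\<^sup>k, y\<^sup>k)\<parallel> \<le> sqrt 2 ^ m * \<parallel>P\<^sub>m\<parallel>\<close> for unit vectors \<open>x\<close>, \<open>y\<close>; by the weighted version with
  \<open>\<epsilon> y\<close> in place of \<open>y\<close>, a bounded number of further slots changes the growth rate by as little as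
  we like. Hence the Taylor coefficients at \<open>a\<close> of every derivative are dominated by those of a
  geometric-type series in \<open>sqrt 2 * (\<parallel>a\<parallel> + \<parallel>h\<parallel>) / \<rho>\<close>, and absolutely convergent double series can
  be rearranged as long as \<open>\<parallel>a\<parallel> + \<parallel>h\<parallel> < \<rho> / sqrt 2\<close>. The bound \<open>\<rho> / sqrt e\<close> is the weaker one, so
  it needs no separate argument.
\<close>

subsection \<open>Continuous multilinear maps\<close>

text \<open>The radius \<open>\<rho>\<close> controls the forms only on the diagonal, whereas
  re-expansion at \<open>a\<close> needs the values of \<open>L (m + k)\<close> at \<open>m\<close>
  copies of \<open>a\<close> and \<open>k\<close> copies of \<open>h\<close>. General polarization
  of a form of degree \<open>N\<close> would cost \<open>N ^ N / fact N\<close>, which grows like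
  \<open>e ^ N\<close> and yields only \<open>\<rho> / e\<close>; the gain comes from the fact that
  only two distinct vectors fill an unbounded number of slots. A second obstacle lies in the notion
  of full analyticity: the Taylor series at \<open>a\<close> must have the right sum wherever it
  converges uniformly inside the ball, possibly outside the region reached by the double series.
  Agreement there is obtained by continuation along a segment.\<close>

definition prepend :: "nat \<Rightarrow> (nat \<Rightarrow> 'a) \<Rightarrow> (nat \<Rightarrow> 'a) \<Rightarrow> nat \<Rightarrow> 'a" where
  "prepend N w v = (\<lambda>i. if i < N then w i else v (i - N))"

text \<open>Nested uses express tuples such as \<open>(a, ..., a, h, ..., h, v 0, v 1, ...)\<close>;
  unfolded, it is the \<open>if i < m\<close> tuple of \<open>tterm\<close> and of the
  theorem.\<close>

abbreviation reps :: "nat \<Rightarrow> 'a \<Rightarrow> (nat \<Rightarrow> 'a) \<Rightarrow> nat \<Rightarrow> 'a" where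
  "reps m x v \<equiv> prepend m (\<lambda>_. x) v"

lemma prepend_0 [simp]: "prepend 0 w v = v"
  by (simp add: prepend_def)

lemma reps_Suc: "reps (Suc m) x v = tcons x (reps m x v)"
  by (auto simp: prepend_def tcons_def fun_eq_iff)

lemma reps_reps: "reps m x (reps n x v) = reps (m + n) x v"
  by (auto simp: prepend_def fun_eq_iff)

lemma prepend_assoc: "prepend m u (prepend n w v) = prepend (m + n) (prepend m u w) v"
  by (auto simp: prepend_def fun_eq_iff)

lemma prepend_upd_less: "i < N \<Longrightarrow> prepend N (w(i := y)) v = (prepend N w v)(i := y)"
  by (auto simp: prepend_def fun_eq_iff)

lemma prepend_upd_add: "prepend N w (v(i := y)) = (prepend N w v)(N + i := y)"
  by (auto simp: prepend_def fun_eq_iff)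

lemma prod_prepend:
  "(\<Prod>i<N + n. f (prepend N w v i)) = (\<Prod>i<N. f (w i)) * (\<Prod>i<n. f (v i))"
proof -
  have "(\<Prod>i<N + n. f (prepend N w v i))
      = (\<Prod>i<N. f (prepend N w v i)) * (\<Prod>i\<in>{N..<N + n}. f (prepend N w v i))"
    by (subst prod.union_disjoint[symmetric]) (auto intro!: prod.cong)
  also have "(\<Prod>i\<in>{N..<N + n}. f (prepend N w v i)) = (\<Prod>i<n. f (prepend N w v (i + N)))"
    by (rule prod.reindex_bij_witness[of _ "\<lambda>i. i + N" "\<lambda>i. i - N"]) auto
  finally show ?thesis
    by (simp add: prepend_def)
qed

lemma bml_cong: "bml p T \<Longrightarrow> (\<And>i. i < p \<Longrightarrow> v i = w i) \<Longrightarrow> T v = T w"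
  unfolding bml_def by blast

lemma bml_linear: "bml p T \<Longrightarrow> i < p \<Longrightarrow> linear (\<lambda>y. T (v(i := y)))"
  unfolding bml_def by blast

lemma bml_bound:
  fixes T :: "(nat \<Rightarrow> 'a::real_normed_vector) \<Rightarrow> 'b::real_normed_vector"
  assumes "bml p T"
  obtains C where "C \<ge> 0" "\<And>v. norm (T v) \<le> C * (\<Prod>i<p. norm (v i))"
proof -
  obtain C where C: "\<And>v. norm (T v) \<le> C * (\<Prod>i<p. norm (v i))"
    using assms unfolding bml_def by blast
  show thesis
  proof (rule that[of "max C 0"])
    fix v :: "nat \<Rightarrow> 'a"
    have "C * (\<Prod>i<p. norm (v i)) \<le> max C 0 * (\<Prod>i<p. norm (v i))"
      by (intro mult_right_mono prod_nonneg) auto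
    with C[of v] show "norm (T v) \<le> max C 0 * (\<Prod>i<p. norm (v i))"
      by linarith
  qed auto
qed

lemma bmlI:
  assumes "\<And>v w. (\<And>i. i < p \<Longrightarrow> v i = w i) \<Longrightarrow> T v = T w"
    and "\<And>i v. i < p \<Longrightarrow> linear (\<lambda>y. T (v(i := y)))"
    and "\<And>v. norm (T v) \<le> C * (\<Prod>i<p. norm (v i))"
  shows "bml p T"
  using assms unfolding bml_def by blast

lemma bml_scale:
  assumes "bml p T"
  shows "T (\<lambda>i. c i *\<^sub>R v i) = (\<Prod>i<p. c i) *\<^sub>R T v"
proof -
  have "j \<le> p \<Longrightarrow> T (\<lambda>i. if i < j then c i *\<^sub>R v i else v i) = (\<Prod>i<j. c i) *\<^sub>R T v" for j
  proof (induction j)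
    case (Suc j)
    let ?w = "\<lambda>i. if i < j then c i *\<^sub>R v i else v i"
    have "T (\<lambda>i. if i < Suc j then c i *\<^sub>R v i else v i) = T (?w(j := c j *\<^sub>R v j))"
      by (rule arg_cong[where f = T]) (auto simp: fun_eq_iff less_Suc_eq)
    also have "\<dots> = c j *\<^sub>R T (?w(j := v j))"
      using linear_scale[OF bml_linear[OF assms, of j ?w], of "c j" "v j"] Suc.prems by simp
    also have "?w(j := v j) = ?w"
      by auto
    finally show ?case
      using Suc by (simp add: mult.commute)
  qed simp
  from this[of p] show ?thesis
    using bml_cong[OF assms, of "\<lambda>i. if i < p then c i *\<^sub>R v i else v i" "\<lambda>i. c i *\<^sub>R v i"] by simp
qed

lemma bml_tcons_add:
  assumes "bml (Suc p) T"
  shows "T (tcons (x + y) v) = T (tcons x v) + T (tcons y v)"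
proof -
  have u: "(tcons 0 v)(0 := z) = tcons z v" for z
    by (auto simp: tcons_def fun_eq_iff)
  show ?thesis
    using linear_add[OF bml_linear[OF assms, of 0 "tcons 0 v"], of x y] unfolding u by simp
qed

lemma bml_prepend_left:
  assumes "bml (N + n) T"
  shows "bml N (\<lambda>w. T (prepend N w v))"
proof -
  obtain C where C: "\<And>v. norm (T v) \<le> C * (\<Prod>i<N + n. norm (v i))"
    using bml_bound[OF assms] by blast
  show ?thesis
  proof (rule bmlI)
    fix w w' :: "nat \<Rightarrow> 'a" assume "\<And>i. i < N \<Longrightarrow> w i = w' i"
    then show "T (prepend N w v) = T (prepend N w' v)"
      by (intro arg_cong[where f = T]) (auto simp: prepend_def)
  next
    fix i and w :: "nat \<Rightarrow> 'a" assume "i < N"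
    then show "linear (\<lambda>y. T (prepend N (w(i := y)) v))"
      using bml_linear[OF assms, of i "prepend N w v"] by (simp add: prepend_upd_less)
  next
    fix w
    show "norm (T (prepend N w v)) \<le> (C * (\<Prod>i<n. norm (v i))) * (\<Prod>i<N. norm (w i))"
      using C[of "prepend N w v"] prod_prepend[where f = norm and N = N and n = n and w = w and v = v] by (simp add: mult_ac)
  qed
qed

lemma bml_prepend_right:
  assumes "bml (N + n) T"
  shows "bml n (\<lambda>v. T (prepend N w v))"
proof -
  obtain C where C: "\<And>v. norm (T v) \<le> C * (\<Prod>i<N + n. norm (v i))"
    using bml_bound[OF assms] by blast
  show ?thesis
  proof (rule bmlI)
    fix v v' :: "nat \<Rightarrow> 'a" assume "\<And>i. i < n \<Longrightarrow> v i = v' i"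
    then show "T (prepend N w v) = T (prepend N w v')"
      by (intro bml_cong[OF assms]) (auto simp: prepend_def)
  next
    fix i and v :: "nat \<Rightarrow> 'a" assume "i < n"
    then show "linear (\<lambda>y. T (prepend N w (v(i := y))))"
      using bml_linear[OF assms, of "N + i" "prepend N w v"] by (simp add: prepend_upd_add)
  next
    fix v
    show "norm (T (prepend N w v)) \<le> (C * (\<Prod>i<N. norm (w i))) * (\<Prod>i<n. norm (v i))"
      using C[of "prepend N w v"] prod_prepend[where f = norm and N = N and n = n and w = w and v = v] by (simp add: mult_ac)
  qed
qed

lemma bml_tcons:
  assumes "bml (Suc p) T" shows "bml p (\<lambda>v. T (tcons y v))"
proof -
  have "prepend 1 (\<lambda>_. y) v = tcons y v" for v :: "nat \<Rightarrow> 'a"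
    by (auto simp: prepend_def tcons_def fun_eq_iff)
  then show ?thesis
    using bml_prepend_right[of 1 p T "\<lambda>_. y"] assms by simp
qed

lemma bml_comp_linear:
  fixes f :: "'c::real_normed_vector \<Rightarrow> 'a::real_normed_vector"
  assumes "bml p T" "bounded_linear f"
  shows "bml p (\<lambda>z. T (\<lambda>i. f (z i)))"
proof -
  obtain C where C0: "C \<ge> 0" and C: "\<And>v. norm (T v) \<le> C * (\<Prod>i<p. norm (v i))"
    using bml_bound[OF assms(1)] by blast
  obtain K where K: "\<And>x. norm (f x) \<le> norm x * K" "K \<ge> 0"
    using bounded_linear.nonneg_bounded[OF assms(2)] by blast
  interpret f: bounded_linear f by fact
  show ?thesis
  proof (rule bmlI)
    fix z z' :: "nat \<Rightarrow> 'c" assume "\<And>i. i < p \<Longrightarrow> z i = z' i"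
    then show "T (\<lambda>i. f (z i)) = T (\<lambda>i. f (z' i))"
      by (intro bml_cong[OF assms(1)]) auto
  next
    fix i and z :: "nat \<Rightarrow> 'c" assume i: "i < p"
    have "(\<lambda>j. f ((z(i := y)) j)) = (\<lambda>j. f (z j))(i := f y)" for y
      by auto
    then show "linear (\<lambda>y. T (\<lambda>j. f ((z(i := y)) j)))"
      using linear_compose[OF f.linear_axioms bml_linear[OF assms(1) i, of "\<lambda>j. f (z j)"]]
      by (simp add: o_def)
  next
    fix z
    have "(\<Prod>i<p. norm (f (z i))) \<le> (\<Prod>i<p. norm (z i) * K)"
      by (intro prod_mono) (auto intro: K)
    also have "\<dots> = (\<Prod>i<p. norm (z i)) * K ^ p"
      by (simp add: prod.distrib)
    finally have "C * (\<Prod>i<p. norm (f (z i))) \<le> C * ((\<Prod>i<p. norm (z i)) * K ^ p)"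
      using C0 by (rule mult_left_mono)
    then show "norm (T (\<lambda>i. f (z i))) \<le> (C * K ^ p) * (\<Prod>i<p. norm (z i))"
      using C[of "\<lambda>i. f (z i)"] by (simp add: mult_ac)
  qed
qed

lemma bml_add:
  assumes "bml p S" "bml p T" shows "bml p (\<lambda>v. S v + T v)"
proof -
  obtain C where C: "\<And>v. norm (S v) \<le> C * (\<Prod>i<p. norm (v i))"
    using bml_bound[OF assms(1)] by blast
  obtain D where D: "\<And>v. norm (T v) \<le> D * (\<Prod>i<p. norm (v i))"
    using bml_bound[OF assms(2)] by blast
  show ?thesis
  proof (rule bmlI)
    show "norm (S v + T v) \<le> (C + D) * (\<Prod>i<p. norm (v i))" for v
      using norm_triangle_ineq[of "S v" "T v"] C[of v] D[of v] by (simp add: algebra_simps)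
  next
    show "S v + T v = S w + T w" if "\<And>i. i < p \<Longrightarrow> v i = w i" for v w
      using bml_cong[OF assms(1), of v w] bml_cong[OF assms(2), of v w] that by simp
  next
    show "linear (\<lambda>y. S (v(i := y)) + T (v(i := y)))" if "i < p" for i v
      by (intro linear_compose_add bml_linear[OF assms(1)] bml_linear[OF assms(2)] that)
  qed
qed

lemma bml_scaleR:
  assumes "bml p T" shows "bml p (\<lambda>v. c *\<^sub>R T v)"
proof -
  obtain C where C: "\<And>v. norm (T v) \<le> C * (\<Prod>i<p. norm (v i))"
    using bml_bound[OF assms(1)] by blast
  show ?thesis
  proof (rule bmlI)
    show "norm (c *\<^sub>R T v) \<le> (\<bar>c\<bar> * C) * (\<Prod>i<p. norm (v i))" for v
      using mult_left_mono[OF C[of v], of "\<bar>c\<bar>"] by (simp add: mult_ac)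
  next
    show "c *\<^sub>R T v = c *\<^sub>R T w" if "\<And>i. i < p \<Longrightarrow> v i = w i" for v w
      using bml_cong[OF assms(1), of v w] that by simp
  next
    show "linear (\<lambda>y. c *\<^sub>R T (v(i := y)))" if "i < p" for i v
      by (intro linear_compose_scale_right bml_linear[OF assms(1)] that)
  qed
qed

lemma bml_zero: "bml p (\<lambda>v. 0)"
  by (rule bmlI[where C = 0]) (auto intro: linear_zero)

lemma bml_diff:
  assumes "bml p S" "bml p T" shows "bml p (\<lambda>v. S v - T v)"
  using bml_add[OF assms(1) bml_scaleR[OF assms(2), of "-1"]] by simp

lemma bml_sum: "(\<And>i. i \<in> I \<Longrightarrow> bml p (T i)) \<Longrightarrow> bml p (\<lambda>v. \<Sum>i\<in>I. T i v)"
  by (induction I rule: infinite_finite_induct) (auto intro: bml_zero bml_add)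

text \<open>The majorant keeps the product of the norms as a separate factor, so the single constant
  \<open>suminf c\<close> bounds the sum on all tuples; pointwise convergence carries linearity over
  to the sum.\<close>

lemma bml_suminf:
  fixes T :: "nat \<Rightarrow> (nat \<Rightarrow> 'a::real_normed_vector) \<Rightarrow> 'b::banach"
  assumes T: "\<And>m. bml p (T m)"
    and c: "summable c" "\<And>m v. norm (T m v) \<le> c m * (\<Prod>i<p. norm (v i))"
  shows "bml p (\<lambda>v. \<Sum>m. T m v)"
proof -
  have sm: "summable (\<lambda>m. c m * (\<Prod>i<p. norm (v i)))" for v :: "nat \<Rightarrow> 'a"
    using c(1) by (rule summable_mult2)
  have sn: "summable (\<lambda>m. norm (T m v))" for v
    by (rule summable_comparison_test[OF _ sm[of v]]) (auto intro: c(2))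
  have s: "summable (\<lambda>m. T m v)" for v
    using sn by (rule summable_norm_cancel)
  show ?thesis
  proof (rule bmlI)
    show "norm (\<Sum>m. T m v) \<le> suminf c * (\<Prod>i<p. norm (v i))" for v
    proof -
      have "norm (\<Sum>m. T m v) \<le> (\<Sum>m. norm (T m v))"
        by (rule summable_norm[OF sn])
      also have "\<dots> \<le> (\<Sum>m. c m * (\<Prod>i<p. norm (v i)))"
        by (rule suminf_le[OF c(2) sn sm])
      also have "\<dots> = suminf c * (\<Prod>i<p. norm (v i))"
        by (rule suminf_mult2[OF c(1), symmetric])
      finally show ?thesis .
    qed
  next
    show "(\<Sum>m. T m v) = (\<Sum>m. T m w)" if "\<And>i. i < p \<Longrightarrow> v i = w i" for v w
      using bml_cong[OF T, of v w] that by simp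
  next
    fix i and v :: "nat \<Rightarrow> 'a" assume i: "i < p"
    show "linear (\<lambda>y. \<Sum>m. T m (v(i := y)))"
    proof (rule linearI)
      fix x y
      show "(\<Sum>m. T m (v(i := x + y))) = (\<Sum>m. T m (v(i := x))) + (\<Sum>m. T m (v(i := y)))"
        using linear_add[OF bml_linear[OF T i]] suminf_add[OF s s] by simp
    next
      fix r x
      show "(\<Sum>m. T m (v(i := r *\<^sub>R x))) = r *\<^sub>R (\<Sum>m. T m (v(i := x)))"
        using linear_scale[OF bml_linear[OF T i]] suminf_scaleR_right[OF s] by simp
    qed
  qed
qed

section \<open>Symmetric forms and their binomial theorem\<close>

lemma msym_permute: "msym p T \<Longrightarrow> \<sigma> permutes {..<p} \<Longrightarrow> T (v \<circ> \<sigma>) = T v"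
  unfolding msym_def by blast

lemma msym_swap:
  assumes "msym p T" "i < p" "j < p"
  shows "T (v \<circ> Transposition.transpose i j) = T v"
  by (rule msym_permute[OF assms(1)]) (use assms in \<open>auto intro: permutes_swap_id\<close>)

lemma msym_prepend_left:
  assumes "msym (N + n) T"
  shows "msym N (\<lambda>w. T (prepend N w v))"
  unfolding msym_def
proof (intro allI impI)
  fix \<sigma> and w :: "nat \<Rightarrow> 'a" assume \<sigma>: "\<sigma> permutes {..<N}"
  have "prepend N (w \<circ> \<sigma>) v = prepend N w v \<circ> \<sigma>"
  proof
    fix i
    show "prepend N (w \<circ> \<sigma>) v i = (prepend N w v \<circ> \<sigma>) i"
    proof (cases "i < N")
      case True
      then have "\<sigma> i < N"
        using permutes_in_image[OF \<sigma>, of i] by simp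
      with True show ?thesis by (simp add: prepend_def)
    next
      case False
      then have "\<sigma> i = i"
        using permutes_not_in[OF \<sigma>, of i] by simp
      with False show ?thesis by (simp add: prepend_def)
    qed
  qed
  moreover have "\<sigma> permutes {..<N + n}"
    by (rule permutes_subset[OF \<sigma>]) auto
  ultimately show "T (prepend N (w \<circ> \<sigma>) v) = T (prepend N w v)"
    using msym_permute[OF assms] by metis
qed

lemma msym_comp:
  assumes "msym p T" shows "msym p (\<lambda>z. T (\<lambda>i. f (z i)))"
  unfolding msym_def
proof (intro allI impI)
  fix \<sigma> v assume "\<sigma> permutes {..<p}"
  from msym_permute[OF assms this, of "\<lambda>i. f (v i)"]
  show "T (\<lambda>i. f ((v \<circ> \<sigma>) i)) = T (\<lambda>i. f (v i))"
    by (simp add: o_def)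
qed

lemma msym_tcons:
  assumes "msym (Suc p) T" shows "msym p (\<lambda>v. T (tcons y v))"
  unfolding msym_def
proof (intro allI impI)
  fix \<sigma> and w :: "nat \<Rightarrow> 'a" assume \<sigma>: "\<sigma> permutes {..<p}"
  \<comment> \<open>\<open>\<tau>\<close> is \<open>\<sigma>\<close> moved one slot to the right;
    slot 0, which holds \<open>y\<close>, stays fixed.\<close>
  define \<tau> where "\<tau> i = (case i of 0 \<Rightarrow> 0 | Suc j \<Rightarrow> Suc (\<sigma> j))" for i
  have "bij \<tau>"
  proof (rule bijI)
    show "inj \<tau>"
      by (rule injI) (auto simp: \<tau>_def inj_eq[OF permutes_inj[OF \<sigma>]] split: nat.splits)
    show "surj \<tau>"
      unfolding surj_def
    proof
      fix i
      show "\<exists>j. i = \<tau> j"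
      proof (cases i)
        case 0 then show ?thesis by (intro exI[of _ 0]) (simp add: \<tau>_def)
      next
        case (Suc k)
        obtain j where "k = \<sigma> j"
          using permutes_surj[OF \<sigma>] by (metis surj_def)
        then show ?thesis using Suc by (intro exI[of _ "Suc j"]) (simp add: \<tau>_def)
      qed
    qed
  qed
  moreover have "\<tau> i = i" if "i \<notin> {..<Suc p}" for i
    using that permutes_not_in[OF \<sigma>, of "i - 1"] by (cases i) (auto simp: \<tau>_def)
  ultimately have "\<tau> permutes {..<Suc p}"
    by (simp add: permutes_def bij_iff)
  moreover have "tcons y (w \<circ> \<sigma>) = tcons y w \<circ> \<tau>"
    by (auto simp: tcons_def \<tau>_def fun_eq_iff split: nat.splits)
  ultimately show "T (tcons y (w \<circ> \<sigma>)) = T (tcons y w)"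
    using msym_permute[OF assms] by metis
qed

text \<open>Slots 1 to \<open>m\<close> all hold \<open>a\<close>, so the single transposition of
  slots 0 and \<open>m\<close> moves \<open>h\<close> behind them.\<close>

lemma msym_tcons_reps:
  assumes "msym p T" "m < p"
  shows "T (tcons h (reps m a w)) = T (reps m a (tcons h w))"
proof -
  have "reps m a (tcons h w) = tcons h (reps m a w) \<circ> Transposition.transpose 0 m"
    by (auto simp: tcons_def prepend_def fun_eq_iff Transposition.transpose_def)
  with msym_swap[OF assms(1), of 0 m "tcons h (reps m a w)"] assms(2) show ?thesis
    by simp
qed

text \<open>Additivity splits slot 0, the induction hypothesis applies to the form with that slot
  fixed, symmetry moves \<open>h\<close> behind the copies of \<open>a\<close>, and Pascal's rule
  adds the coefficients.\<close>

lemma binomial_reps: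
  fixes T :: "(nat \<Rightarrow> 'a::real_normed_vector) \<Rightarrow> 'b::real_normed_vector"
  assumes "bml (N + n) T" "msym (N + n) T"
  shows "T (reps N (a + h) v) = (\<Sum>k\<le>N. real (N choose k) *\<^sub>R T (reps (N - k) a (reps k h v)))"
  using assms
proof (induction N arbitrary: T)
  case 0
  then show ?case by simp
next
  case (Suc N)
  define t where "t k = T (reps (Suc N - k) a (reps k h v))" for k
  have 1: "T (tcons a (reps (N - k) a (reps k h v))) = t k" if "k \<le> N" for k
    using that unfolding t_def by (simp add: Suc_diff_le reps_Suc)
  have 2: "T (tcons h (reps (N - k) a (reps k h v))) = t (Suc k)" if "k \<le> N" for k
    using that msym_tcons_reps[OF Suc.prems(2), of "N - k" h a "reps k h v"]
    unfolding t_def by (simp add: reps_Suc)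
  have "T (reps (Suc N) (a + h) v)
      = (\<Sum>k\<le>N. real (N choose k) *\<^sub>R T (tcons (a + h) (reps (N - k) a (reps k h v))))"
    using Suc.IH[of "\<lambda>w. T (tcons (a + h) w)"] bml_tcons[of "N + n" T] msym_tcons[of "N + n" T] Suc.prems
    by (simp add: reps_Suc)
  also have "\<dots> = (\<Sum>k\<le>N. real (N choose k) *\<^sub>R t k + real (N choose k) *\<^sub>R t (Suc k))"
    using Suc.prems by (intro sum.cong) (auto simp: bml_tcons_add[of "N + n"] 1 2 scaleR_add_right)
  also have "\<dots> = (\<Sum>k\<le>N. real (N choose k) *\<^sub>R t k) + (\<Sum>k\<le>N. real (N choose k) *\<^sub>R t (Suc k))"
    by (rule sum.distrib)
  also have "(\<Sum>k\<le>N. real (N choose k) *\<^sub>R t k) = t 0 + (\<Sum>k\<le>N. real (N choose Suc k) *\<^sub>R t (Suc k))"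
  proof -
    have "(\<Sum>k\<le>N. real (N choose k) *\<^sub>R t k) = (\<Sum>k\<le>Suc N. real (N choose k) *\<^sub>R t k)"
      by simp
    also have "\<dots> = t 0 + (\<Sum>k\<le>N. real (N choose Suc k) *\<^sub>R t (Suc k))"
      by (subst sum.atMost_Suc_shift) simp
    finally show ?thesis .
  qed
  also have "t 0 + (\<Sum>k\<le>N. real (N choose Suc k) *\<^sub>R t (Suc k)) + (\<Sum>k\<le>N. real (N choose k) *\<^sub>R t (Suc k))
      = t 0 + (\<Sum>k\<le>N. real (Suc N choose Suc k) *\<^sub>R t (Suc k))"
    by (simp add: sum.distrib scaleR_add_left add_ac)
  also have "\<dots> = (\<Sum>k\<le>Suc N. real (Suc N choose k) *\<^sub>R t k)"
    by (subst sum.atMost_Suc_shift) simp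
  finally show ?case
    unfolding t_def .
qed

section \<open>The operator norm of a multilinear map\<close>

text \<open>Even the lower bound rests on \<open>c\<close>: the supremum of an unbounded set of
  reals is unspecified. The zero tuple makes the set nonempty.\<close>

lemma mnorm_bounds:
  assumes "\<And>v. (\<And>i. i < p \<Longrightarrow> norm (v i) \<le> 1) \<Longrightarrow> norm (T v) \<le> c"
  shows "0 \<le> mnorm p T" "mnorm p T \<le> c"
proof -
  let ?S = "{norm (T v) | v. \<forall>i<p. norm (v i) \<le> 1}"
  have z: "norm (T (\<lambda>_. 0)) \<in> ?S"
    by force
  have "bdd_above ?S"
    by (rule bdd_aboveI[of _ c]) (use assms in blast)
  from cSup_upper[OF z this] show "0 \<le> mnorm p T"
    unfolding mnorm_def by (rule order_trans[OF norm_ge_zero])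
  show "mnorm p T \<le> c"
    unfolding mnorm_def by (rule cSup_least) (use z assms in blast)+
qed

lemma norm_le_mnorm:
  assumes "bml p T" shows "norm (T v) \<le> mnorm p T * (\<Prod>i<p. norm (v i))"
proof -
  let ?S = "{norm (T v) | v. \<forall>i<p. norm (v i) \<le> 1}"
  obtain C where C0: "C \<ge> 0" and C: "\<And>v. norm (T v) \<le> C * (\<Prod>i<p. norm (v i))"
    using bml_bound[OF assms] by blast
  have "bdd_above ?S"
  proof (rule bdd_aboveI[of _ C])
    fix x assume "x \<in> ?S"
    then obtain v where v: "x = norm (T v)" "\<forall>i<p. norm (v i) \<le> 1" by blast
    have "(\<Prod>i<p. norm (v i)) \<le> 1"
      by (rule prod_le_1) (use v in auto)
    with C[of v] C0 show "x \<le> C"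
      unfolding v(1) by (meson mult_left_le order_trans)
  qed
  then have ub: "norm (T u) \<le> mnorm p T" if "\<And>i. i < p \<Longrightarrow> norm (u i) \<le> 1" for u
    unfolding mnorm_def by (rule cSup_upper[rotated]) (use that in blast)
  \<comment> \<open>Since \<open>inverse 0 = 0\<close>, a zero entry of \<open>v\<close> gives
    \<open>u i = 0\<close>, so \<open>v i = norm (v i) *\<^sub>R u i\<close> holds without a case
    split.\<close>
  define u where "u i = v i /\<^sub>R norm (v i)" for i
  have "T v = T (\<lambda>i. norm (v i) *\<^sub>R u i)"
    by (rule arg_cong[where f = T]) (simp add: u_def fun_eq_iff field_simps)
  also have "\<dots> = (\<Prod>i<p. norm (v i)) *\<^sub>R T u"
    by (rule bml_scale[OF assms])
  finally have "norm (T v) = (\<Prod>i<p. norm (v i)) * norm (T u)"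
    by (simp add: abs_prod)
  also have "\<dots> \<le> (\<Prod>i<p. norm (v i)) * mnorm p T"
    by (intro mult_left_mono ub prod_nonneg) (auto simp: u_def field_simps)
  finally show ?thesis by (simp add: mult.commute)
qed

subsection \<open>Banach's theorem in the plane\<close>

text \<open>Here \<open>complex\<close> serves as the Euclidean plane with real basis
  \<open>1\<close>, \<open>\<i>\<close>. Expanding every slot in that basis makes \<open>T\<close> a
  polynomial in finitely many coordinates, hence continuous for the product topology, in which the
  set of unit tuples is compact.\<close>

lemma continuous_on_bml_complex:
  fixes T :: "(nat \<Rightarrow> complex) \<Rightarrow> 'b::real_normed_vector"
  assumes T: "bml m T"
  shows "continuous_on UNIV T"
proof -
  have "j \<le> m \<Longrightarrow> continuous_on UNIV (\<lambda>v. T (\<lambda>i. if i < j then v i else w i))" for j w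
  proof (induction j arbitrary: w)
    case (Suc j)
    \<comment> \<open>Slot \<open>j\<close> is expanded in the basis; its two values are frozen into
      the tail \<open>w\<close>, to which the induction hypothesis applies.\<close>
    have eq: "T (\<lambda>i. if i < Suc j then v i else w i)
        = Re (v j) *\<^sub>R T (\<lambda>i. if i < j then v i else (w(j := 1)) i)
        + Im (v j) *\<^sub>R T (\<lambda>i. if i < j then v i else (w(j := \<i>)) i)" for v
    proof -
      let ?u = "\<lambda>i. if i < j then v i else w i"
      have u: "(\<lambda>i. if i < j then v i else (w(j := z)) i) = ?u(j := z)" for z
        by auto
      have "(\<lambda>i. if i < Suc j then v i else w i) = ?u(j := Re (v j) *\<^sub>R 1 + Im (v j) *\<^sub>R \<i>)"
        by (auto simp: fun_eq_iff less_Suc_eq complex_eq_iff)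
      moreover have lin: "linear (\<lambda>y. T (?u(j := y)))"
        using Suc.prems by (intro bml_linear[OF T]) simp
      ultimately show ?thesis
        unfolding u using linear_add[OF lin, of "Re (v j) *\<^sub>R 1" "Im (v j) *\<^sub>R \<i>"]
          linear_scale[OF lin, of "Re (v j)" 1] linear_scale[OF lin, of "Im (v j)" \<i>] by metis
    qed
    show ?case
      unfolding eq using Suc.prems
      by (intro continuous_intros Suc.IH continuous_on_compose2[OF continuous_on_Re[OF continuous_on_id]]
          continuous_on_compose2[OF continuous_on_Im[OF continuous_on_id]]) auto
  qed simp
  from this[of m "\<lambda>_. 0"] show ?thesis
    using bml_cong[OF T, of "\<lambda>i. if i < m then _ i else 0"] by simp
qed

lemma sum_fun_upd2:
  fixes f :: "'c \<Rightarrow> 'd::comm_monoid_add" and m :: nat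
  assumes "i < m" "j < m" "i \<noteq> j"
  shows "(\<Sum>k<m. f ((w(i := x, j := y)) k)) = f x + f y + (\<Sum>k\<in>{..<m} - {i, j}. f (w k))"
proof -
  have "{..<m} = insert i (insert j ({..<m} - {i, j}))"
    using assms by auto
  then have "(\<Sum>k<m. f ((w(i := x, j := y)) k))
      = (\<Sum>k\<in>insert i (insert j ({..<m} - {i, j})). f ((w(i := x, j := y)) k))"
    by simp
  also have "\<dots> = f x + (f y + (\<Sum>k\<in>{..<m} - {i, j}. f ((w(i := x, j := y)) k)))"
    using assms by (subst sum.insert sum.insert; simp)+
  also have "(\<Sum>k\<in>{..<m} - {i, j}. f ((w(i := x, j := y)) k)) = (\<Sum>k\<in>{..<m} - {i, j}. f (w k))"
    by (intro sum.cong) auto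
  finally show ?thesis by (simp only: add.assoc)
qed

text \<open>
  Banach's theorem in the plane. Among the unit tuples that maximize the norm of \<open>T\<close>, take
  one that maximizes the sum of the inner products with a fixed vector \<open>e\<close>. Its entries agree:
  otherwise the identity \<open>4 T(x, y) = T(x + y, x + y) - T(x - y, x - y)\<close> together with the
  parallelogram law shows that replacing two distinct entries \<open>x\<close>, \<open>y\<close> by the normalized
  \<open>x + y\<close> keeps the tuple maximizing and increases the sum.
\<close>
lemma symmetric_bml_complex_bound:
  fixes T :: "(nat \<Rightarrow> complex) \<Rightarrow> 'b::real_normed_vector"
  assumes T: "bml m T" and sym: "msym m T"
    and diag: "\<And>x. norm x = 1 \<Longrightarrow> norm (T (\<lambda>_. x)) \<le> B"
    and v: "\<And>i. i < m \<Longrightarrow> norm (v i) = 1"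
  shows "norm (T v) \<le> B"
proof (cases "m = 0")
  case True
  then have "T v = T (\<lambda>_. 1)"
    by (intro bml_cong[OF T]) simp
  then show ?thesis using diag[of 1] by simp
next
  case False
  then have m0: "0 < m" by simp
  \<comment> \<open>Every slot is normalized, including those from \<open>m\<close> on, so that
    \<open>K\<close> is a full product of circles and Tychonoff's theorem applies.\<close>
  define K :: "(nat \<Rightarrow> complex) set" where "K = {v. \<forall>i. norm (v i) = 1}"
  have "K = PiE UNIV (\<lambda>_. sphere 0 1)"
    by (auto simp: K_def PiE_def Pi_def)
  then have "compactin (product_topology (\<lambda>_. euclidean) UNIV) K"
    by (simp add: compactin_PiE)
  then have K: "compact K"
    by (simp add: euclidean_product_topology)
  have cT: "continuous_on S (\<lambda>v. norm (T v))" for S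
    using continuous_on_subset[OF continuous_on_bml_complex[OF T]] by (intro continuous_on_norm) auto
  have "(\<lambda>_. 1) \<in> K"
    by (simp add: K_def)
  then obtain v0 where v0: "v0 \<in> K" and max: "\<And>v. v \<in> K \<Longrightarrow> norm (T v) \<le> norm (T v0)"
    using continuous_attains_sup[OF K _ cT] by blast
  define M where "M = norm (T v0)"
  \<comment> \<open>An entry of a maximizing tuple is taken as \<open>e\<close>, so that some
    maximizing tuple has a nonzero inner product with \<open>e\<close> and the maximum of
    \<open>\<phi>\<close> is positive.\<close>
  define e where "e = v0 0"
  have e: "norm e = 1"
    using v0 by (simp add: e_def K_def)
  define K1 where "K1 = K \<inter> {v. norm (T v) = M}"
  have "closed {v. norm (T v) = M}"
    using cT by (intro closed_Collect_eq continuous_on_const)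
  then have K1: "compact K1"
    unfolding K1_def using K by (rule compact_Int_closed[rotated])
  define \<phi> where "\<phi> v = (\<Sum>i<m. v i \<bullet> e)" for v :: "nat \<Rightarrow> complex"
  have c\<phi>: "continuous_on K1 \<phi>"
    unfolding \<phi>_def
    by (intro continuous_intros continuous_on_subset[OF continuous_on_product_coordinates]) auto
  have flip: "(\<lambda>i. c i *\<^sub>R u i) \<in> K1" if "u \<in> K1" "\<And>i. \<bar>c i\<bar> = 1" for c u
    using that by (auto simp: K1_def K_def bml_scale[OF T] abs_prod)
  have "v0 \<in> K1"
    using v0 by (simp add: K1_def M_def)
  then obtain w where w: "w \<in> K1" and wmax: "\<And>v. v \<in> K1 \<Longrightarrow> \<phi> v \<le> \<phi> w"
    using continuous_attains_sup[OF K1 _ c\<phi>] by blast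
  \<comment> \<open>Sign changes preserve \<open>norm (T u)\<close>. Choosing the signs so that all
    inner products become nonnegative turns \<open>\<phi>\<close> into a sum of absolute values;
    hence \<open>\<phi> w\<close> is positive and \<open>w\<close> has no negative inner
    product.\<close>
  define \<sigma> where "\<sigma> u i = (if u i \<bullet> e < 0 then -1 else 1 :: real)" for u :: "nat \<Rightarrow> complex" and i :: nat
  have \<sigma>: "\<bar>\<sigma> u i\<bar> = 1" "\<sigma> u i * (u i \<bullet> e) = \<bar>u i \<bullet> e\<bar>" for u i
    by (auto simp: \<sigma>_def)
  have "0 < \<bar>v0 0 \<bullet> e\<bar>"
    using e unfolding e_def by (simp add: norm_eq_1)
  also have "\<dots> \<le> (\<Sum>i<m. \<bar>v0 i \<bullet> e\<bar>)"
    using m0 by (intro member_le_sum) auto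
  also have "\<dots> = \<phi> (\<lambda>i. \<sigma> v0 i *\<^sub>R v0 i)"
    by (simp add: \<phi>_def \<sigma>)
  also have "\<dots> \<le> \<phi> w"
    by (intro wmax flip \<open>v0 \<in> K1\<close> \<sigma>)
  finally have pos: "0 < \<phi> w" .
  have nonneg: "0 \<le> w i \<bullet> e" if "i < m" for i
  proof -
    have "(\<Sum>i<m. \<bar>w i \<bullet> e\<bar>) = \<phi> (\<lambda>i. \<sigma> w i *\<^sub>R w i)"
      by (simp add: \<phi>_def \<sigma>)
    also have "\<dots> \<le> \<phi> w"
      by (intro wmax flip w \<sigma>)
    finally have "(\<Sum>i<m. \<bar>w i \<bullet> e\<bar> - w i \<bullet> e) \<le> 0"
      by (simp add: \<phi>_def sum_subtractf)
    moreover have "\<bar>w i \<bullet> e\<bar> - w i \<bullet> e \<le> (\<Sum>i<m. \<bar>w i \<bullet> e\<bar> - w i \<bullet> e)"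
      using that by (intro member_le_sum) auto
    ultimately show ?thesis by linarith
  qed
  obtain i where i: "i < m" "0 < w i \<bullet> e"
  proof -
    have "\<not> (\<forall>i<m. w i \<bullet> e \<le> 0)"
      using pos sum_nonpos[of "{..<m}" "\<lambda>i. w i \<bullet> e"] unfolding \<phi>_def by fastforce
    then show thesis using that by force
  qed
  have wK: "norm (w k) = 1" for k
    using w by (simp add: K1_def K_def)
  have wM: "norm (T w) = M"
    using w by (simp add: K1_def)
  have eq: "w j = w i" if j: "j < m" for j
  proof (rule ccontr)
    assume neq: "w j \<noteq> w i"
    then have ij: "i \<noteq> j" by auto
    define Q where "Q a b = T (w(i := a, j := b))" for a b
    have lin2: "linear (Q a)" for a
      unfolding Q_def by (rule bml_linear[OF T j])
    have Qsym: "Q a b = Q b a" for a b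
    proof -
      have "w(i := b, j := a) = w(i := a, j := b) \<circ> Transposition.transpose i j"
        using ij by (auto simp: fun_eq_iff Transposition.transpose_def)
      then show ?thesis
        unfolding Q_def using msym_swap[OF sym i(1) j, of "w(i := a, j := b)"] by simp
    qed
    have add: "Q a (b + c) = Q a b + Q a c" "Q (b + c) a = Q b a + Q c a"
      "Q a (b - c) = Q a b - Q a c" "Q (b - c) a = Q b a - Q c a" for a b c
      using linear_add[OF lin2] linear_diff[OF lin2] Qsym by metis+
    have Qscale: "Q (r *\<^sub>R a) (r *\<^sub>R a) = r\<^sup>2 *\<^sub>R Q a a" for r a
      using linear_scale[OF lin2] Qsym by (metis power2_eq_square scaleR_scaleR)
    define s where "s = w i + w j"
    define d where "d = w i - w j"
    have "(norm s)\<^sup>2 + (norm d)\<^sup>2 = 2 * (norm (w i))\<^sup>2 + 2 * (norm (w j))\<^sup>2"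
      unfolding power2_norm_eq_inner s_def d_def
      by (simp add: inner_add_left inner_add_right inner_diff_left inner_diff_right)
    then have sd: "(norm s)\<^sup>2 + (norm d)\<^sup>2 = 4"
      by (simp add: wK)
    have d0: "norm d > 0"
      using neq by (simp add: d_def)
    have se: "s \<bullet> e > 0"
      using i nonneg[OF j] by (simp add: s_def inner_add_left)
    then have s0: "norm s > 0"
      by auto
    have Qle: "norm (Q z z) \<le> (norm z)\<^sup>2 * M" if "z \<noteq> 0" for z
    proof -
      define x where "x = z /\<^sub>R norm z"
      have x: "z = norm z *\<^sub>R x" "norm x = 1"
        using that by (auto simp: x_def)
      have "w(i := x, j := x) \<in> K"
        using wK x(2) by (simp add: K_def)
      then have "norm (Q x x) \<le> M"
        unfolding Q_def M_def by (rule max)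
      moreover have "norm (Q z z) = (norm z)\<^sup>2 * norm (Q x x)"
        using Qscale[of "norm z" x] x(1) by simp
      ultimately show ?thesis
        by (simp add: mult_left_mono)
    qed
    define x where "x = s /\<^sub>R norm s"
    have x: "s = norm s *\<^sub>R x" "norm x = 1"
      using s0 by (auto simp: x_def)
    have xK: "w(i := x, j := x) \<in> K"
      using wK x(2) by (simp add: K_def)
    \<comment> \<open>Writing 4 as two doublings lets \<open>scaleR_2\<close> produce the sums that
      the bilinear expansion of \<open>Q s s - Q d d\<close> yields.\<close>
    have "4 *\<^sub>R Q (w i) (w j) = 2 *\<^sub>R 2 *\<^sub>R Q (w i) (w j)"
      by simp
    then have "4 *\<^sub>R Q (w i) (w j) = Q s s - Q d d"
      unfolding s_def d_def scaleR_2 using Qsym[of "w j" "w i"] by (simp add: add)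
    moreover have "Q (w i) (w j) = T w"
      by (simp add: Q_def)
    ultimately have "4 * M = norm (Q s s - Q d d)"
      using wM by (metis abs_numeral norm_scaleR)
    also have "\<dots> \<le> norm (Q s s) + norm (Q d d)"
      by (rule norm_triangle_ineq4)
    also have "norm (Q s s) = (norm s)\<^sup>2 * norm (Q x x)"
      using Qscale[of "norm s" x] x(1) by simp
    also have "norm (Q d d) \<le> (norm d)\<^sup>2 * M"
      using d0 by (intro Qle) auto
    \<comment> \<open>The two weights sum to 4 and \<open>Q d d\<close> contributes at most its
      share \<open>(norm d)\<^sup>2 * M\<close>, so \<open>Q s s\<close> must attain its full share;
      thus the tuple with both entries \<open>x\<close> is again maximizing.\<close>
    finally have "((norm s)\<^sup>2 + (norm d)\<^sup>2) * M \<le> (norm s)\<^sup>2 * norm (Q x x) + (norm d)\<^sup>2 * M"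
      using sd by simp
    then have "(norm s)\<^sup>2 * M \<le> (norm s)\<^sup>2 * norm (Q x x)"
      by (simp add: algebra_simps)
    then have "M \<le> norm (Q x x)"
      using s0 by simp
    then have "w(i := x, j := x) \<in> K1"
      using max[OF xK] xK unfolding K1_def Q_def M_def by auto
    \<comment> \<open>The remaining entries cancel in \<open>\<phi>\<close>. As \<open>x\<close> is
      \<open>s\<close> scaled to norm 1, maximality forces \<open>norm s \<ge> 2\<close>, and the
      parallelogram law leaves no room for \<open>d \<noteq> 0\<close>.\<close>
    from wmax[OF this] have "2 * (x \<bullet> e) \<le> s \<bullet> e"
      using sum_fun_upd2[OF i(1) j ij, of "\<lambda>z. z \<bullet> e" w x x]
        sum_fun_upd2[OF i(1) j ij, of "\<lambda>z. z \<bullet> e" w "w i" "w j"]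
      unfolding \<phi>_def by (simp add: s_def inner_add_left)
    moreover have "x \<bullet> e = (s \<bullet> e) / norm s"
      by (simp add: x_def divide_inverse mult.commute)
    ultimately have "2 * (s \<bullet> e) \<le> norm s * (s \<bullet> e)"
      using s0 by (simp add: field_simps)
    then have "2 \<le> norm s"
      using se by simp
    then have "4 \<le> (norm s)\<^sup>2"
      using power_mono[of 2 "norm s" 2] by simp
    with sd zero_less_power[OF d0, of 2] show False by linarith
  qed
  \<comment> \<open>Slots from \<open>m\<close> on may have any norm in \<open>v\<close>; they are
    reset to 1 to land in \<open>K\<close>.\<close>
  have "norm (T v) = norm (T (\<lambda>i. if i < m then v i else 1))"
    by (intro arg_cong[where f = norm] bml_cong[OF T]) simp
  also have "\<dots> \<le> M"
    unfolding M_def by (rule max) (simp add: K_def v)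
  also have "M = norm (T (\<lambda>_. w i))"
    unfolding wM[symmetric] by (intro arg_cong[where f = norm] bml_cong[OF T] eq)
  also have "\<dots> \<le> B"
    by (rule diag) (rule wK)
  finally show ?thesis .
qed

text \<open>The pullback of \<open>T\<close> to the plane is evaluated at \<open>m\<close> copies of
  \<open>1\<close> and \<open>k\<close> copies of \<open>\<i>\<close>. The weights stay free for two
  uses: \<open>s = t = 1\<close> costs \<open>sqrt 2\<close> per slot, while \<open>s = 1\<close>,
  \<open>t = \<epsilon>\<close> costs nearly 1 per slot and \<open>1 / \<epsilon>\<close> for each
  copy of \<open>h\<close>.\<close>

lemma symmetric_bml_two_vectors:
  fixes T :: "(nat \<Rightarrow> 'a::real_normed_vector) \<Rightarrow> 'b::real_normed_vector"
  assumes T: "bml (m + k) T" and sym: "msym (m + k) T" and B: "B \<ge> 0"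
    and diag: "\<And>x. norm (T (\<lambda>_. x)) \<le> B * norm x ^ (m + k)"
    and st: "s \<ge> 0" "t \<ge> 0"
  shows "norm (T (reps m a (\<lambda>_. h))) * (s ^ m * t ^ k)
    \<le> B * sqrt (s\<^sup>2 + t\<^sup>2) ^ (m + k) * (norm a ^ m * norm h ^ k)"
proof -
  define u where "u = a /\<^sub>R norm a"
  define g where "g = h /\<^sub>R norm h"
  have u: "a = norm a *\<^sub>R u" "norm u \<le> 1"
    by (auto simp: u_def field_simps)
  have g: "h = norm h *\<^sub>R g" "norm g \<le> 1"
    by (auto simp: g_def field_simps)
  have scale: "T (reps m (c *\<^sub>R y) (\<lambda>_. d *\<^sub>R z)) = (c ^ m * d ^ k) *\<^sub>R T (reps m y (\<lambda>_. z))" for c d y z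
  proof -
    have "reps m (c *\<^sub>R y) (\<lambda>_. d *\<^sub>R z) = (\<lambda>i. reps m c (\<lambda>_. d) i *\<^sub>R reps m y (\<lambda>_. z) i)"
      by (auto simp: prepend_def)
    then show ?thesis
      by (simp add: bml_scale[OF T] prod_prepend[where f = "\<lambda>x. x"])
  qed
  define f :: "complex \<Rightarrow> 'a" where "f z = Re z *\<^sub>R s *\<^sub>R u + Im z *\<^sub>R t *\<^sub>R g" for z
  have f: "bounded_linear f"
    unfolding f_def
    by (intro bounded_linear_add bounded_linear_scaleR_const[OF bounded_linear_Re]
        bounded_linear_scaleR_const[OF bounded_linear_Im])
  have norm_f: "norm (f z) \<le> sqrt (s\<^sup>2 + t\<^sup>2)" if "norm z = 1" for z
  proof -
    have "norm (f z) \<le> norm (Re z *\<^sub>R s *\<^sub>R u) + norm (Im z *\<^sub>R t *\<^sub>R g)"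
      unfolding f_def by (rule norm_triangle_ineq)
    also have "\<dots> \<le> \<bar>Re z\<bar> * s + \<bar>Im z\<bar> * t"
      using st by (intro add_mono) (auto simp: abs_mult mult.assoc intro!: mult_left_mono mult_left_le u g)
    also have "\<dots> \<le> sqrt (s\<^sup>2 + t\<^sup>2)"
    proof (rule real_le_rsqrt)
      \<comment> \<open>Lagrange's identity, giving Cauchy-Schwarz in the plane.\<close>
      have "(\<bar>Re z\<bar> * s + \<bar>Im z\<bar> * t)\<^sup>2 + (\<bar>Re z\<bar> * t - \<bar>Im z\<bar> * s)\<^sup>2
          = (\<bar>Re z\<bar>\<^sup>2 + \<bar>Im z\<bar>\<^sup>2) * (s\<^sup>2 + t\<^sup>2)"
        by algebra
      also have "\<bar>Re z\<bar>\<^sup>2 + \<bar>Im z\<bar>\<^sup>2 = 1"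
        using that by (simp add: cmod_def)
      finally show "(\<bar>Re z\<bar> * s + \<bar>Im z\<bar> * t)\<^sup>2 \<le> s\<^sup>2 + t\<^sup>2"
        using zero_le_power2[of "\<bar>Re z\<bar> * t - \<bar>Im z\<bar> * s"] by (simp only: mult_1)
    qed
    finally show ?thesis .
  qed
  have "norm (T (\<lambda>i. f (reps m 1 (\<lambda>_. \<i>) i))) \<le> B * sqrt (s\<^sup>2 + t\<^sup>2) ^ (m + k)"
  proof (rule symmetric_bml_complex_bound[OF bml_comp_linear[OF T f] msym_comp[OF sym]])
    fix z :: complex assume "norm z = 1"
    then have "B * norm (f z) ^ (m + k) \<le> B * sqrt (s\<^sup>2 + t\<^sup>2) ^ (m + k)"
      by (intro mult_left_mono power_mono norm_f B) auto
    with diag[of "f z"] show "norm (T (\<lambda>_. f z)) \<le> B * sqrt (s\<^sup>2 + t\<^sup>2) ^ (m + k)"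
      by linarith
  qed (simp add: prepend_def)
  moreover have "(\<lambda>i. f (reps m 1 (\<lambda>_. \<i>) i)) = reps m (s *\<^sub>R u) (\<lambda>_. t *\<^sub>R g)"
    by (auto simp: prepend_def f_def)
  ultimately have "norm (T (reps m u (\<lambda>_. g))) * (s ^ m * t ^ k) \<le> B * sqrt (s\<^sup>2 + t\<^sup>2) ^ (m + k)"
    using st by (simp add: scale mult.commute)
  then have "norm (T (reps m u (\<lambda>_. g))) * (s ^ m * t ^ k) * (norm a ^ m * norm h ^ k)
      \<le> B * sqrt (s\<^sup>2 + t\<^sup>2) ^ (m + k) * (norm a ^ m * norm h ^ k)"
    by (rule mult_right_mono) simp
  moreover have "norm (T (reps m a (\<lambda>_. h))) = (norm a ^ m * norm h ^ k) * norm (T (reps m u (\<lambda>_. g)))"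
    by (subst u(1), subst g(1), subst scale) simp
  ultimately show ?thesis
    by (simp add: mult_ac)
qed

subsection \<open>Mixed arguments and double series\<close>

text \<open>The trailing slots are removed from the end. Fixing slot \<open>m + n\<close> at
  \<open>v n\<close> leaves a symmetric form of degree \<open>m + n\<close>, whose diagonal bound
  comes from \<open>symmetric_bml_two_vectors\<close> with \<open>s = 1\<close>,
  \<open>t = \<epsilon>\<close>, \<open>k = 1\<close>.\<close>

lemma symmetric_bml_reps_bound:
  fixes T :: "(nat \<Rightarrow> 'a::real_normed_vector) \<Rightarrow> 'b::real_normed_vector"
  assumes \<epsilon>: "\<epsilon> > 0" and B: "B \<ge> 0"
    and "bml (m + n) T" "msym (m + n) T"
    and "\<And>x. norm (T (\<lambda>_. x)) \<le> B * norm x ^ (m + n)"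
  shows "norm (T (reps m x v))
    \<le> B * (sqrt (1 + \<epsilon>\<^sup>2) ^ (m + n) / \<epsilon>) ^ n * norm x ^ m * (\<Prod>i<n. norm (v i))"
  using assms(2-)
proof (induction n arbitrary: T B)
  case 0
  have "T (reps m x v) = T (\<lambda>_. x)"
    by (rule bml_cong[OF 0(2)]) (simp add: prepend_def)
  with 0 show ?case by simp
next
  case (Suc n)
  define q where "q = sqrt (1 + \<epsilon>\<^sup>2)"
  have q: "1 \<le> q"
    by (simp add: q_def)
  define T' where "T' w = T (prepend (m + n) w (\<lambda>_. v n))" for w
  define B' where "B' = B * q ^ (m + Suc n) / \<epsilon> * norm (v n)"
  have T: "bml ((m + n) + 1) T" "msym ((m + n) + 1) T"
    using Suc.prems by simp_all
  have T': "bml (m + n) T'" "msym (m + n) T'"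
    unfolding T'_def by (rule bml_prepend_left[OF T(1)] msym_prepend_left[OF T(2)])+
  have B': "B' \<ge> 0"
    using Suc.prems(1) \<epsilon> q by (auto simp: B'_def)
  have diag': "norm (T' (\<lambda>_. y)) \<le> B' * norm y ^ (m + n)" for y
  proof -
    have "norm (T (reps (m + n) y (\<lambda>_. v n))) * (1 ^ (m + n) * \<epsilon> ^ 1)
        \<le> B * sqrt (1\<^sup>2 + \<epsilon>\<^sup>2) ^ (m + n + 1) * (norm y ^ (m + n) * norm (v n) ^ 1)"
      by (rule symmetric_bml_two_vectors[OF T]) (use Suc.prems \<epsilon> in auto)
    then show ?thesis
      using \<epsilon> by (simp add: T'_def B'_def q_def field_simps)
  qed
  have "T (reps m x v) = T' (reps m x v)"
    unfolding T'_def
    by (rule bml_cong[OF Suc.prems(2)]) (auto simp: prepend_def not_less less_Suc_eq intro!: arg_cong[where f = v])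
  then have "norm (T (reps m x v))
      \<le> B' * (q ^ (m + n) / \<epsilon>) ^ n * norm x ^ m * (\<Prod>i<n. norm (v i))"
    using Suc.IH[OF B' T' diag'] by (simp add: q_def)
  \<comment> \<open>The exponent is enlarged so that all removed slots carry the same
    factor.\<close>
  also have "\<dots> \<le> B' * (q ^ (m + Suc n) / \<epsilon>) ^ n * norm x ^ m * (\<Prod>i<n. norm (v i))"
    using q \<epsilon> by (intro mult_right_mono mult_left_mono power_mono divide_right_mono B' prod_nonneg
        power_increasing) auto
  also have "\<dots> = B * (q ^ (m + Suc n) / \<epsilon>) ^ Suc n * norm x ^ m * (\<Prod>i<Suc n. norm (v i))"
    by (simp add: B'_def mult_ac)
  finally show ?case unfolding q_def .
qed

text \<open>With \<open>v\<close> fixed, the preceding lemma is the diagonal bound of a symmetric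
  form in the first \<open>m + k\<close> slots; equal weights then separate \<open>a\<close> from
  \<open>h\<close>.\<close>

lemma symmetric_bml_reps_reps_bound:
  fixes T :: "(nat \<Rightarrow> 'a::real_normed_vector) \<Rightarrow> 'b::real_normed_vector"
  assumes \<epsilon>: "\<epsilon> > 0" and B: "B \<ge> 0"
    and T: "bml (m + k + n) T" and sym: "msym (m + k + n) T"
    and diag: "\<And>x. norm (T (\<lambda>_. x)) \<le> B * norm x ^ (m + k + n)"
  shows "norm (T (reps m a (reps k h v)))
    \<le> B * (sqrt (1 + \<epsilon>\<^sup>2) ^ (m + k + n) / \<epsilon>) ^ n * sqrt 2 ^ (m + k)
        * (norm a ^ m * norm h ^ k) * (\<Prod>i<n. norm (v i))"
proof -
  define B' where "B' = B * (sqrt (1 + \<epsilon>\<^sup>2) ^ (m + k + n) / \<epsilon>) ^ n * (\<Prod>i<n. norm (v i))"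
  have B': "B' \<ge> 0"
    using B \<epsilon> by (auto simp: B'_def intro!: mult_nonneg_nonneg prod_nonneg)
  have "norm (T (prepend (m + k) (reps m a (\<lambda>_. h)) v)) * (1 ^ m * 1 ^ k)
      \<le> B' * sqrt (1\<^sup>2 + 1\<^sup>2) ^ (m + k) * (norm a ^ m * norm h ^ k)"
  proof (rule symmetric_bml_two_vectors[OF bml_prepend_left[OF T] msym_prepend_left[OF sym] B'])
    show "norm (T (reps (m + k) x v)) \<le> B' * norm x ^ (m + k)" for x
      using symmetric_bml_reps_bound[OF \<epsilon> B T sym diag, of x v] by (simp add: B'_def mult_ac)
  qed auto
  then show ?thesis
    by (simp add: prepend_assoc B'_def mult_ac)
qed

text \<open>The Cauchy product with the geometric series raises \<open>n\<close> by one, by the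
  hockey-stick identity for binomial coefficients.\<close>

lemma summable_binomial_power:
  fixes x :: real
  assumes "0 \<le> x" "x < 1"
  shows "summable (\<lambda>N. real ((N + n) choose n) * x ^ N)"
proof (induction n)
  case 0
  then show ?case using assms by (simp add: summable_geometric)
next
  case (Suc n)
  have "summable (\<lambda>N. \<Sum>i\<le>N. (real ((i + n) choose n) * x ^ i) * x ^ (N - i))"
    by (rule summable_Cauchy_product) (use assms Suc in \<open>simp_all add: abs_mult summable_geometric\<close>)
  also have "(\<lambda>N. \<Sum>i\<le>N. (real ((i + n) choose n) * x ^ i) * x ^ (N - i))
      = (\<lambda>N. real ((N + Suc n) choose Suc n) * x ^ N)"
  proof
    fix N
    have sym: "(i + n) choose n = (n + i) choose i" for i
      by (subst binomial_symmetric) (auto simp: add.commute)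
    have "(\<Sum>i\<le>N. (real ((i + n) choose n) * x ^ i) * x ^ (N - i))
        = (\<Sum>i\<le>N. real ((n + i) choose i)) * x ^ N"
      unfolding sum_distrib_right
      by (intro sum.cong) (simp_all add: sym mult.assoc flip: power_add)
    also have "(\<Sum>i\<le>N. real ((n + i) choose i)) = real (Suc (n + N) choose N)"
      using sum_choose_lower[of n N] by (simp flip: of_nat_sum)
    also have "Suc (n + N) choose N = (N + Suc n) choose Suc n"
      by (subst binomial_symmetric) (auto simp: add.commute)
    finally show "(\<Sum>i\<le>N. (real ((i + n) choose n) * x ^ i) * x ^ (N - i))
        = real ((N + Suc n) choose Suc n) * x ^ N" .
  qed
  finally show ?case .
qed

text \<open>Fubini for absolutely summable families, with \<open>(k, m)\<close> reindexed as
  \<open>(m + k, k)\<close>. The majorant is assumed summable along antidiagonals because there the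
  binomial theorem gives its sums in closed form.\<close>

lemma diagonal_rearrangement:
  fixes f :: "nat \<Rightarrow> nat \<Rightarrow> 'b::banach"
  assumes le: "\<And>m k. norm (f m k) \<le> b m k"
    and s: "summable (\<lambda>N. \<Sum>k\<le>N. b (N - k) k)"
  shows "\<And>k. summable (\<lambda>m. b m k)" "summable (\<lambda>k. \<Sum>m. b m k)"
    "(\<lambda>k. \<Sum>m. f m k) sums (\<Sum>N. \<Sum>k\<le>N. f (N - k) k)"
proof -
  have b0: "b m k \<ge> 0" for m k
    by (rule order_trans[OF norm_ge_zero le])
  have infsum_suminf: "infsum g UNIV = suminf g" if "g summable_on UNIV" for g :: "nat \<Rightarrow> 'c::banach"
    using has_sum_imp_sums[OF has_sum_infsum[OF that]] by (simp add: sums_iff)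
  let ?S = "Sigma UNIV (\<lambda>N::nat. {..N})"
  have reindex: "(\<lambda>(k, m). g m k) summable_on UNIV \<times> UNIV \<longleftrightarrow> (\<lambda>(N, k). g (N - k) k) summable_on ?S"
    "infsum (\<lambda>(k, m). g m k) (UNIV \<times> UNIV) = infsum (\<lambda>(N, k). g (N - k) k) ?S"
    for g :: "nat \<Rightarrow> nat \<Rightarrow> 'c::banach"
    by (rule summable_on_reindex_bij_witness[where i = "\<lambda>(N, k). (k, N - k)" and j = "\<lambda>(k, m). (m + k, k)"]
        infsum_reindex_bij_witness[where i = "\<lambda>(N, k). (k, N - k)" and j = "\<lambda>(k, m). (m + k, k)"]; auto)+
  have "(\<lambda>p. norm ((\<lambda>(N, k). b (N - k) k) p)) summable_on ?S"
    unfolding Infinite_Sum.abs_summable_on_Sigma_iff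
    using b0 s by (auto simp: summable_on_UNIV_nonneg_real_iff sum_nonneg)
  then have "(\<lambda>(N, k). b (N - k) k) summable_on ?S"
    by (rule abs_summable_summable)
  then have bs: "(\<lambda>(k, m). b m k) summable_on UNIV \<times> UNIV"
    by (simp only: reindex)
  then have "(\<lambda>p. norm ((\<lambda>(k, m). b m k) p)) summable_on UNIV \<times> UNIV"
    by (rule summable_on_iff_abs_summable_on_real[THEN iffD1])
  then have b_inner: "(\<lambda>m. b m k) summable_on UNIV" for k
    unfolding Infinite_Sum.abs_summable_on_Sigma_iff using b0 by simp
  then show "summable (\<lambda>m. b m k)" for k
    by (rule summable_on_imp_summable)
  show "summable (\<lambda>k. \<Sum>m. b m k)"
    using summable_on_imp_summable[OF summable_on_Sigma_banach[OF bs]] by (simp add: infsum_suminf[OF b_inner])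
  have "(\<lambda>p. norm ((\<lambda>(k, m). f m k) p)) summable_on UNIV \<times> UNIV"
    by (rule Infinite_Sum.abs_summable_on_comparison_test'[OF bs]) (auto intro: le)
  then have fs: "(\<lambda>(k, m). f m k) summable_on UNIV \<times> UNIV"
    by (rule abs_summable_summable)
  have f_inner: "(\<lambda>m. f m k) summable_on UNIV" for k
    by (rule abs_summable_summable[OF Infinite_Sum.abs_summable_on_comparison_test'[OF b_inner]]) (rule le)
  have fs': "(\<lambda>(N, k). f (N - k) k) summable_on ?S"
    using fs by (simp only: reindex)
  have outer: "(\<lambda>k. \<Sum>m. f m k) summable_on UNIV" "(\<lambda>N. \<Sum>k\<le>N. f (N - k) k) summable_on UNIV"
    using summable_on_Sigma_banach[OF fs] summable_on_Sigma_banach[OF fs']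
    by (simp_all add: infsum_suminf[OF f_inner])
  have "(\<Sum>\<^sub>\<infinity>k. \<Sum>m. f m k) = infsum (\<lambda>(k, m). f m k) (UNIV \<times> UNIV)"
    using infsum_Sigma'_banach[OF fs] by (simp add: infsum_suminf[OF f_inner])
  also have "\<dots> = (\<Sum>\<^sub>\<infinity>N. \<Sum>k\<le>N. f (N - k) k)"
    unfolding reindex using infsum_Sigma'_banach[OF fs'] by simp
  finally have "(\<Sum>\<^sub>\<infinity>k. \<Sum>m. f m k) = (\<Sum>N. \<Sum>k\<le>N. f (N - k) k)"
    by (simp add: infsum_suminf[OF outer(2)])
  then show "(\<lambda>k. \<Sum>m. f m k) sums (\<Sum>N. \<Sum>k\<le>N. f (N - k) k)"
    using has_sum_imp_sums[OF has_sum_infsum[OF outer(1)]] by simp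
qed

subsection \<open>Taylor expansion of a power series\<close>

lemma norm_sums_tail_le:
  fixes g :: "nat \<Rightarrow> 'b::banach"
  assumes "g sums S" "summable G" "\<And>k. norm (g k) \<le> G k"
  shows "norm (S - (\<Sum>k<M. g k)) \<le> (\<Sum>k. G (k + M))"
proof -
  have "summable (\<lambda>k. G (k + M))"
    using assms(2) by (rule summable_ignore_initial_segment)
  then have "norm (\<Sum>k. g (k + M)) \<le> (\<Sum>k. G (k + M))"
    by (rule norm_suminf_le[rotated]) (rule assms(3))
  moreover have "(\<Sum>k. g (k + M)) = S - (\<Sum>k<M. g k)"
    using suminf_minus_initial_segment[OF sums_summable[OF assms(1)], of M] sums_unique[OF assms(1)] by simp
  ultimately show ?thesis by simp
qed

text \<open>
  For \<open>F x = (\<Sum>m. L\<^sub>m(x, \<dots>, x))\<close> this is the candidate for the \<open>n\<close>-th derivative, with the \<open>n\<close>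
  directions in \<open>v\<close>.
\<close>
definition deriv_series ::
    "(nat \<Rightarrow> (nat \<Rightarrow> 'a) \<Rightarrow> 'b::real_normed_vector) \<Rightarrow> nat \<Rightarrow> 'a \<Rightarrow> (nat \<Rightarrow> 'a) \<Rightarrow> 'b" where
  "deriv_series L n x v =
     (\<Sum>m. (fact n * real ((m + n) choose n)) *\<^sub>R L (m + n) (reps m x v))"

text \<open>\<open>K\<close> stands for the reciprocal of a radius on which everything converges,
  and \<open>C n\<close> for the price of \<open>n\<close> further slots, independent of
  \<open>m\<close> and \<open>k\<close>. Besides the given series, a power series on the real line
  will be an instance.\<close>

locale symmetric_power_series =
  fixes L :: "nat \<Rightarrow> (nat \<Rightarrow> 'a::real_normed_vector) \<Rightarrow> 'b::banach"
    and C :: "nat \<Rightarrow> real" and K :: real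
  assumes L_bml: "bml m (L m)" and L_msym: "msym m (L m)" and K_pos: "K > 0" and C_nonneg: "C n \<ge> 0"
    and L_bound: "norm (L (m + k + n) (reps m a (reps k h v)))
      \<le> C n * K ^ (m + k + n) * (norm a ^ m * norm h ^ k) * (\<Prod>i<n. norm (v i))"
begin

abbreviation D where "D \<equiv> deriv_series L"

abbreviation taylor_term where
  "taylor_term n a h v k \<equiv> (1 / fact k) *\<^sub>R D (n + k) a (reps k h v)"

text \<open>Each \<open>L (m + k + n)\<close> is expanded at \<open>a + h\<close> by
  \<open>binomial_reps\<close> and the double series is summed by \<open>k\<close> first. Majorizing
  with \<open>\<beta>\<close> in place of \<open>norm h\<close> gives coefficients \<open>e\<close>
  that serve all \<open>h\<close> and \<open>v\<close>.\<close>

lemma taylor: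
  assumes \<beta>: "\<beta> > 0" and conv: "(norm a + \<beta>) * K < 1"
  obtains e where "\<And>k. e k \<ge> 0" "summable (\<lambda>k. e k * \<beta> ^ k)"
    "\<And>h v k. norm (taylor_term n a h v k) \<le> e k * norm h ^ k * (\<Prod>i<n. norm (v i))"
    "\<And>h v. norm h \<le> \<beta> \<Longrightarrow> taylor_term n a h v sums D n (a + h) v"
proof -
  \<comment> \<open>This is \<open>fact (m + k + n) / (fact m * fact k)\<close>. It is both the
    coefficient in the binomial expansion of \<open>D n (a + h)\<close> and
    \<open>1 / fact k\<close> times the coefficient in \<open>D (n + k) a\<close>, which is why the
    rearranged sum is the Taylor series.\<close>
  define c :: "nat \<Rightarrow> nat \<Rightarrow> real"
    where "c m k = fact n * real ((m + k + n) choose n) * real ((m + k) choose k)" for m k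
  define d where "d m k = c m k * (C n * K ^ (m + k + n) * norm a ^ m)" for m k
  define f where "f h v m k = c m k *\<^sub>R L (m + k + n) (reps m a (reps k h v))" for h v m k
  have c0: "c m k \<ge> 0" and d0: "d m k \<ge> 0" for m k
    using K_pos C_nonneg by (auto simp: c_def d_def)
  have f_le: "norm (f h v m k) \<le> d m k * norm h ^ k * (\<Prod>i<n. norm (v i))" for h v m k
    using mult_left_mono[OF L_bound[of m k n a h v] c0[of m k]] c0
    by (simp add: f_def d_def mult_ac)
  have diag: "(\<Sum>k\<le>N. d (N - k) k * \<beta> ^ k)
      = (C n * K ^ n * fact n) * (real ((N + n) choose n) * ((norm a + \<beta>) * K) ^ N)" for N
  proof -
    have "(\<Sum>k\<le>N. d (N - k) k * \<beta> ^ k)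
        = (C n * K ^ n * fact n * real ((N + n) choose n) * K ^ N)
          * (\<Sum>k\<le>N. real (N choose k) * \<beta> ^ k * norm a ^ (N - k))"
      unfolding sum_distrib_left
      by (intro sum.cong) (auto simp: d_def c_def power_add mult_ac)
    also have "(\<Sum>k\<le>N. real (N choose k) * \<beta> ^ k * norm a ^ (N - k)) = (norm a + \<beta>) ^ N"
      by (subst add.commute) (rule binomial_ring[symmetric])
    finally show ?thesis
      by (simp add: power_mult_distrib mult_ac)
  qed
  have sum_diag: "summable (\<lambda>N. \<Sum>k\<le>N. d (N - k) k * \<beta> ^ k)"
    unfolding diag using K_pos \<beta> conv by (intro summable_mult summable_binomial_power) auto
  have "norm (d m k * \<beta> ^ k) \<le> d m k * \<beta> ^ k" for m k
    using d0 \<beta> by (simp add: abs_mult)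
  from diagonal_rearrangement[of "\<lambda>m k. d m k * \<beta> ^ k", OF this sum_diag]
  have inner: "summable (\<lambda>m. d m k * \<beta> ^ k)" and outer: "summable (\<lambda>k. \<Sum>m. d m k * \<beta> ^ k)" for k
    by blast+
  have d_sum: "summable (\<lambda>m. d m k)" for k
    using inner[of k] \<beta> by (intro summable_mult_D[of "\<beta> ^ k" "\<lambda>m. d m k"]) (simp_all add: mult.commute)
  have term_eq: "taylor_term n a h v k = (\<Sum>m. f h v m k)" for h v k
  proof -
    have "(fact (n + k) * real ((m + (n + k)) choose (n + k))) = fact k * c m k" for m
      by (simp add: c_def binomial_fact field_simps add_ac)
    then have "D (n + k) a (reps k h v) = (\<Sum>m. fact k *\<^sub>R f h v m k)"
      unfolding deriv_series_def f_def by (simp add: add_ac)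
    also have "\<dots> = fact k *\<^sub>R (\<Sum>m. f h v m k)"
    proof (rule suminf_scaleR_right[symmetric])
      show "summable (\<lambda>m. f h v m k)"
        by (rule summable_comparison_test'[OF summable_mult2[OF summable_mult2[OF d_sum]] f_le])
    qed
    finally show ?thesis by simp
  qed
  show thesis
  proof (rule that[of "\<lambda>k. \<Sum>m. d m k"])
    show "0 \<le> (\<Sum>m. d m k)" for k
      by (intro suminf_nonneg d_sum d0)
    show "summable (\<lambda>k. (\<Sum>m. d m k) * \<beta> ^ k)"
      using outer by (simp add: suminf_mult2[OF d_sum])
    show "norm (taylor_term n a h v k) \<le> (\<Sum>m. d m k) * norm h ^ k * (\<Prod>i<n. norm (v i))" for h v k
    proof -
      have "norm (\<Sum>m. f h v m k) \<le> (\<Sum>m. d m k * norm h ^ k * (\<Prod>i<n. norm (v i)))"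
        by (rule norm_suminf_le[OF f_le summable_mult2[OF summable_mult2[OF d_sum]]])
      then show ?thesis
        unfolding term_eq by (simp add: suminf_mult2[OF d_sum] suminf_mult2[OF summable_mult2[OF d_sum]])
    qed
    fix h :: 'a and v :: "nat \<Rightarrow> 'a" assume h: "norm h \<le> \<beta>"
    have "norm (f h v m k) \<le> d m k * \<beta> ^ k * (\<Prod>i<n. norm (v i))" for m k
      by (rule order_trans[OF f_le])
        (intro mult_right_mono mult_left_mono power_mono h d0 prod_nonneg norm_ge_zero; simp)
    moreover have "summable (\<lambda>N. \<Sum>k\<le>N. d (N - k) k * \<beta> ^ k * (\<Prod>i<n. norm (v i)))"
      using summable_mult2[OF sum_diag] by (simp add: sum_distrib_right)
    ultimately have "(\<lambda>k. \<Sum>m. f h v m k) sums (\<Sum>N. \<Sum>k\<le>N. f h v (N - k) k)"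
      by (rule diagonal_rearrangement(3))
    moreover have "(\<Sum>k\<le>N. f h v (N - k) k)
        = (fact n * real ((N + n) choose n)) *\<^sub>R L (N + n) (reps N (a + h) v)" for N
      unfolding binomial_reps[OF L_bml L_msym] scaleR_sum_right
      by (intro sum.cong) (auto simp: f_def c_def)
    ultimately show "taylor_term n a h v sums D n (a + h) v"
      unfolding term_eq unfolding deriv_series_def by simp
  qed
qed

lemma bml_D:
  assumes "norm x * K < 1"
  shows "bml n (D n x)"
  unfolding deriv_series_def[abs_def]
proof (rule bml_suminf)
  show "bml n (\<lambda>v. (fact n * real ((m + n) choose n)) *\<^sub>R L (m + n) (reps m x v))" for m
    by (intro bml_scaleR bml_prepend_right L_bml)
  have "summable (\<lambda>m. (C n * K ^ n * fact n) * (real ((m + n) choose n) * (norm x * K) ^ m))"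
    using assms K_pos by (intro summable_mult summable_binomial_power) auto
  then show "summable (\<lambda>m. fact n * real ((m + n) choose n) * (C n * K ^ (m + n) * norm x ^ m))"
    by (simp add: power_add power_mult_distrib mult_ac)
  show "norm ((fact n * real ((m + n) choose n)) *\<^sub>R L (m + n) (reps m x v))
      \<le> fact n * real ((m + n) choose n) * (C n * K ^ (m + n) * norm x ^ m) * (\<Prod>i<n. norm (v i))" for m v
    using mult_left_mono[OF L_bound[of m 0 n x 0 v], of "fact n * real ((m + n) choose n)"]
    by (simp add: mult_ac)
qed

lemma exists_taylor_radius:
  assumes "norm a * K < 1"
  obtains \<delta> where "\<delta> > 0" "(norm a + \<delta>) * K < 1"
proof -
  define \<delta> where "\<delta> = (1 / K - norm a) / 2"
  have "norm a < 1 / K"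
    using assms K_pos by (simp add: field_simps)
  then have "\<delta> > 0" "norm a + \<delta> < 1 / K"
    by (auto simp: \<delta>_def field_simps)
  then show thesis
    using K_pos by (intro that) (auto simp: field_simps)
qed

text \<open>The power \<open>norm h ^ j\<close> is taken out of the tail. The case
  \<open>j = 2\<close> gives differentiability, \<open>j = 1\<close> continuity.\<close>

lemma taylor_remainder:
  assumes "norm a * K < 1"
  obtains \<delta> M where "\<delta> > 0" "M \<ge> 0"
    "\<And>h v. norm h \<le> \<delta> \<Longrightarrow> norm (D n (a + h) v - (\<Sum>k<j. taylor_term n a h v k))
      \<le> M * norm h ^ j * (\<Prod>i<n. norm (v i))"
proof -
  obtain \<delta> where \<delta>: "\<delta> > 0" "(norm a + \<delta>) * K < 1"
    using exists_taylor_radius[OF assms] .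
  obtain e where e: "\<And>k. e k \<ge> 0" "summable (\<lambda>k. e k * \<delta> ^ k)"
    "\<And>h v k. norm (taylor_term n a h v k) \<le> e k * norm h ^ k * (\<Prod>i<n. norm (v i))"
    "\<And>h v. norm h \<le> \<delta> \<Longrightarrow> taylor_term n a h v sums D n (a + h) v"
    using taylor[OF \<delta>, where n = n] by blast
  have "summable (\<lambda>k. e (k + j) * \<delta> ^ (k + j))"
    using e(2) by (rule summable_ignore_initial_segment)
  then have s: "summable (\<lambda>k. e (k + j) * \<delta> ^ k)"
    using \<delta>(1)
    by (intro summable_mult_D[of "\<delta> ^ j" "\<lambda>k. e (k + j) * \<delta> ^ k"]) (simp_all add: power_add mult_ac)
  show thesis
  proof (rule that[of \<delta> "\<Sum>k. e (k + j) * \<delta> ^ k"])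
    show "(\<Sum>k. e (k + j) * \<delta> ^ k) \<ge> 0"
      using s e(1) \<delta>(1) by (intro suminf_nonneg) auto
    fix h :: 'a and v :: "nat \<Rightarrow> 'a" assume h: "norm h \<le> \<delta>"
    let ?P = "\<Prod>i<n. norm (v i)"
    have P: "?P \<ge> 0"
      by (simp add: prod_nonneg)
    have le: "e k * norm h ^ k * ?P \<le> e k * \<delta> ^ k * ?P" for k
      by (intro mult_right_mono mult_left_mono power_mono h e(1) P) auto
    have sum1: "summable (\<lambda>k. e k * norm h ^ k * ?P)"
      by (rule summable_comparison_test'[OF summable_mult2[OF e(2), of ?P]])
        (use le e(1) P in \<open>auto simp: abs_mult\<close>)
    have "norm (D n (a + h) v - (\<Sum>k<j. taylor_term n a h v k))
        \<le> (\<Sum>k. e (k + j) * norm h ^ (k + j) * ?P)"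
      by (rule norm_sums_tail_le[OF e(4)[OF h] sum1 e(3)])
    also have "\<dots> \<le> (\<Sum>k. e (k + j) * \<delta> ^ k * (norm h ^ j * ?P))"
    proof (rule suminf_le)
      show "e (k + j) * norm h ^ (k + j) * ?P \<le> e (k + j) * \<delta> ^ k * (norm h ^ j * ?P)" for k
        unfolding power_add mult.assoc
        by (intro mult_left_mono mult_right_mono power_mono h e(1) mult_nonneg_nonneg P) auto
      show "summable (\<lambda>k. e (k + j) * norm h ^ (k + j) * ?P)"
        using sum1 by (rule summable_ignore_initial_segment)
      show "summable (\<lambda>k. e (k + j) * \<delta> ^ k * (norm h ^ j * ?P))"
        using s by (rule summable_mult2)
    qed
    also have "\<dots> = (\<Sum>k. e (k + j) * \<delta> ^ k) * norm h ^ j * ?P"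
      using suminf_mult2[OF s, of "norm h ^ j * ?P"] by (simp add: mult.assoc)
    finally show "norm (D n (a + h) v - (\<Sum>k<j. taylor_term n a h v k))
        \<le> (\<Sum>k. e (k + j) * \<delta> ^ k) * norm h ^ j * ?P" .
  qed (rule \<delta>(1))
qed

lemma mfderiv_D:
  assumes "norm a * K < 1"
  shows "mfderiv n (D n) (D (Suc n) a) a"
  unfolding mfderiv_def
proof
  show "bml (Suc n) (D (Suc n) a)"
    by (rule bml_D[OF assms])
  let ?R = "\<lambda>h v. D n (a + h) v - D n a v - D (Suc n) a (tcons h v)"
  obtain \<delta> M where \<delta>: "\<delta> > 0" "M \<ge> 0"
    and rem: "\<And>h v. norm h \<le> \<delta> \<Longrightarrow> norm (D n (a + h) v - (\<Sum>k<2. taylor_term n a h v k))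
      \<le> M * norm h ^ 2 * (\<Prod>i<n. norm (v i))"
    using taylor_remainder[OF assms, of n 2] by blast
  have two: "(\<Sum>k<2. taylor_term n a h v k) = D n a v + D (Suc n) a (tcons h v)" for h v
    by (simp add: numeral_2_eq_2 reps_Suc)
  have bound: "norm (mnorm n (?R h) / norm h) \<le> M * norm h" if h: "norm h \<le> \<delta>" for h
  proof -
    have R: "norm (?R h v) \<le> M * norm h ^ 2" if "\<And>i. i < n \<Longrightarrow> norm (v i) \<le> 1" for v
    proof -
      have "norm (?R h v) \<le> M * norm h ^ 2 * (\<Prod>i<n. norm (v i))"
        using rem[OF h, of v] unfolding two by (simp add: diff_diff_eq)
      also have "\<dots> \<le> M * norm h ^ 2 * 1"
        using that \<delta>(2) by (intro mult_left_mono prod_le_1) auto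
      finally show ?thesis by simp
    qed
    have "0 \<le> mnorm n (?R h)" "mnorm n (?R h) \<le> M * norm h ^ 2"
      by (rule mnorm_bounds[OF R]; assumption)+
    then show ?thesis
      by (cases "h = 0") (auto simp: field_simps power2_eq_square)
  qed
  have "eventually (\<lambda>h::'a. norm h \<le> \<delta>) (at 0)"
    unfolding eventually_at using \<delta>(1) by (intro exI[of _ \<delta>]) auto
  then have "\<forall>\<^sub>F h in at 0. norm (mnorm n (?R h) / norm h) \<le> M * norm h"
    by (rule eventually_mono) (rule bound)
  moreover have "((\<lambda>h::'a. M * norm h) \<longlongrightarrow> 0) (at 0)"
    by (intro tendsto_mult_right_zero tendsto_norm_zero tendsto_ident_at)
  ultimately show "((\<lambda>h. mnorm n (?R h) / norm h) \<longlongrightarrow> 0) (at 0)"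
    by (rule Lim_null_comparison)
qed

lemma dtower_D:
  assumes "open U" "\<And>x. x \<in> U \<Longrightarrow> norm x * K < 1"
  shows "dtower n U (D n) (\<lambda>k. D (n + k))"
  unfolding dtower_def using assms bml_D mfderiv_D[of _ "n + _"] by auto

lemma tterm_D: "tterm (\<lambda>k. D (n + k)) a k x v = taylor_term n a (x - a) v k"
  by (simp add: tterm_def prepend_def)

text \<open>The Weierstrass test with the majorant \<open>e k * \<beta> ^ k\<close> from
  \<open>taylor\<close>, the limit being \<open>D n\<close> itself.\<close>

lemma uconv_tterm_D:
  assumes "0 \<le> r" "(norm a + r) * K < 1"
  shows "uconv n (cball a r) (tterm (\<lambda>k. D (n + k)) a)"
proof -
  \<comment> \<open>Strictly above \<open>r\<close>, so that \<open>\<beta> > 0\<close> also when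
    \<open>r = 0\<close>.\<close>
  obtain \<beta> where \<beta>: "r < \<beta>" "(norm a + \<beta>) * K < 1"
  proof -
    define \<beta> where "\<beta> = ((1 / K - norm a) + r) / 2"
    have "norm a + r < 1 / K"
      using assms K_pos by (simp add: field_simps)
    then have "r < \<beta>" "norm a + \<beta> < 1 / K"
      by (auto simp: \<beta>_def field_simps)
    then show thesis
      using K_pos by (intro that) (auto simp: field_simps)
  qed
  then have \<beta>0: "\<beta> > 0"
    using assms by simp
  obtain e where e: "\<And>k. e k \<ge> 0" "summable (\<lambda>k. e k * \<beta> ^ k)"
    "\<And>h v k. norm (taylor_term n a h v k) \<le> e k * norm h ^ k * (\<Prod>i<n. norm (v i))"
    "\<And>h v. norm h \<le> \<beta> \<Longrightarrow> taylor_term n a h v sums D n (a + h) v"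
    using taylor[OF \<beta>0 \<beta>(2), where n = n] by blast
  have bml: "bml n (D n x)" if "x \<in> cball a r" for x
  proof (rule bml_D)
    have "norm x \<le> norm a + r"
      using that norm_triangle_sub[of x a] by (auto simp: dist_norm norm_minus_commute)
    then show "norm x * K < 1"
      using assms(2) K_pos by (meson le_less_trans mult_right_mono less_imp_le)
  qed
  have tail: "mnorm n (\<lambda>v. (\<Sum>m<M. tterm (\<lambda>k. D (n + k)) a m x v) - D n x v)
      \<le> (\<Sum>k. e (k + M) * \<beta> ^ (k + M))" if x: "x \<in> cball a r" for M x
  proof (rule mnorm_bounds(2))
    fix v :: "nat \<Rightarrow> 'a" assume v: "\<And>i. i < n \<Longrightarrow> norm (v i) \<le> 1"
    have h: "norm (x - a) \<le> \<beta>"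
      using x \<beta>(1) by (simp add: dist_norm norm_minus_commute)
    have "norm (taylor_term n a (x - a) v k) \<le> e k * \<beta> ^ k" for k
    proof -
      have "e k * norm (x - a) ^ k * (\<Prod>i<n. norm (v i)) \<le> e k * \<beta> ^ k * 1"
        by (intro mult_mono mult_left_mono power_mono h e(1) prod_le_1 conjI v mult_nonneg_nonneg
            prod_nonneg zero_le_power) (use \<beta>0 v in auto)
      with e(3)[of k "x - a" v] show ?thesis by linarith
    qed
    from norm_sums_tail_le[OF e(4)[OF h] e(2) this, of M]
    show "norm ((\<Sum>m<M. tterm (\<lambda>k. D (n + k)) a m x v) - D n x v) \<le> (\<Sum>k. e (k + M) * \<beta> ^ (k + M))"
      unfolding tterm_D by (simp add: norm_minus_commute)
  qed
  show ?thesis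
    unfolding uconv_def
  proof (intro exI[of _ "D n"] conjI ballI allI impI)
    fix \<epsilon> :: real assume "\<epsilon> > 0"
    then obtain N where N: "\<And>M. M \<ge> N \<Longrightarrow> norm (\<Sum>k. e (k + M) * \<beta> ^ (k + M)) < \<epsilon>"
      using suminf_exist_split[OF _ e(2)] by blast
    show "\<exists>N. \<forall>M\<ge>N. \<forall>x\<in>cball a r.
        mnorm n (\<lambda>v. (\<Sum>m<M. tterm (\<lambda>k. D (n + k)) a m x v) - D n x v) < \<epsilon>"
    proof (intro exI[of _ N] allI impI ballI)
      fix M x assume "N \<le> M" "x \<in> cball a r"
      with tail[of x M] N[of M]
      show "mnorm n (\<lambda>v. (\<Sum>m<M. tterm (\<lambda>k. D (n + k)) a m x v) - D n x v) < \<epsilon>"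
        by simp
    qed
  qed (rule bml)
qed

end

subsection \<open>Agreement on the domain of uniform convergence\<close>

lemma reps_same: "reps m x (\<lambda>_. x) = (\<lambda>_. x)"
  by (auto simp: prepend_def)

lemma bml_reps_scale:
  assumes "bml (m + n) T"
  shows "T (reps m (c *\<^sub>R x) v) = c ^ m *\<^sub>R T (reps m x v)"
proof -
  have "reps m (c *\<^sub>R x) v = (\<lambda>i. reps m c (\<lambda>_. 1) i *\<^sub>R reps m x v i)"
    by (auto simp: prepend_def)
  then show ?thesis
    by (simp add: bml_scale[OF assms] prod_prepend[where f = "\<lambda>x. x"])
qed

lemma deriv_series_0:
  assumes "\<And>m. bml m (L m)"
  shows "deriv_series L n 0 v = fact n *\<^sub>R L n v"
proof -
  have "L (m + n) (reps m 0 v) = 0" if "m > 0" for m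
    using bml_reps_scale[OF assms, of m n 0 0 v] that by (metis scaleR_zero_left zero_power)
  then have "(fact n * real ((m + n) choose n)) *\<^sub>R L (m + n) (reps m 0 v) = 0" if "m \<notin> {0}" for m
    using that by simp
  then show ?thesis
    unfolding deriv_series_def by (subst suminf_finite[of "{0}"]) auto
qed

text \<open>The series with terms \<open>t ^ k *\<^sub>R c k\<close> on the real line: its
  \<open>k\<close>-linear form multiplies the entries. Bounded coefficients give convergence for
  absolute value of \<open>t\<close> below 1, hence \<open>K = 1\<close>.\<close>

lemma symmetric_power_series_real:
  fixes c :: "nat \<Rightarrow> 'b::banach"
  assumes M: "\<And>k. norm (c k) \<le> M"
  shows "symmetric_power_series (\<lambda>k w. (\<Prod>i<k. w i :: real) *\<^sub>R c k) (\<lambda>_. M) 1"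
proof
  show "bml m (\<lambda>w. (\<Prod>i<m. w i :: real) *\<^sub>R c m)" for m
  proof (rule bmlI)
    show "(\<Prod>i<m. v i) *\<^sub>R c m = (\<Prod>i<m. w i) *\<^sub>R c m" if "\<And>i. i < m \<Longrightarrow> v i = w i" for v w :: "nat \<Rightarrow> real"
      using that by simp
    show "norm ((\<Prod>i<m. v i) *\<^sub>R c m) \<le> norm (c m) * (\<Prod>i<m. norm (v i))" for v :: "nat \<Rightarrow> real"
      by (simp add: abs_prod)
    fix i and v :: "nat \<Rightarrow> real" assume i: "i < m"
    have "(\<Prod>j<m. (v(i := y)) j) = y * (\<Prod>j\<in>{..<m} - {i}. v j)" for y
      using i by (subst prod.remove[of _ i]) (auto intro!: prod.cong)
    then show "linear (\<lambda>y. (\<Prod>j<m. (v(i := y)) j) *\<^sub>R c m)"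
      by (auto intro!: linearI simp: algebra_simps)
  qed
  show "msym m (\<lambda>w. (\<Prod>i<m. w i :: real) *\<^sub>R c m)" for m
    unfolding msym_def using prod.permute by (metis (no_types))
  show "0 \<le> M"
    using norm_ge_zero M by (rule order_trans)
  fix m k n and a h :: real and v :: "nat \<Rightarrow> real"
  have "(\<Prod>i<m + k + n. norm (reps m a (reps k h v) i)) = norm a ^ m * norm h ^ k * (\<Prod>i<n. norm (v i))"
    using prod_prepend[where f = norm and N = m and n = "k + n" and w = "\<lambda>_. a" and v = "reps k h v"]
      prod_prepend[where f = norm and N = k and n = n and w = "\<lambda>_. h" and v = v]
    by (simp add: add.assoc mult.assoc)
  then show "norm ((\<Prod>i<m + k + n. reps m a (reps k h v) i) *\<^sub>R c (m + k + n))
      \<le> M * 1 ^ (m + k + n) * (norm a ^ m * norm h ^ k) * (\<Prod>i<n. norm (v i))"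
    using M[of "m + k + n"]
    by (simp add: abs_prod mult.commute[of M] mult.assoc mult_left_mono prod_nonneg)
qed simp

text \<open>Identity principle with a uniform step: \<open>f k\<close> and \<open>g k\<close> play
  the role of \<open>k\<close>-th derivatives. All orders are compared together, since one step
  needs every derivative at its starting point.\<close>

lemma taylor_stepping_unique:
  fixes f g :: "nat \<Rightarrow> real \<Rightarrow> 'b::real_normed_vector"
  assumes d: "d > 0"
    and f: "\<And>k t s. 0 \<le> t \<Longrightarrow> t \<le> s \<Longrightarrow> s \<le> b \<Longrightarrow> s - t \<le> d \<Longrightarrow>
      (\<lambda>j. ((s - t) ^ j / fact j) *\<^sub>R f (k + j) t) sums f k s"
    and g: "\<And>k t s. 0 \<le> t \<Longrightarrow> t \<le> s \<Longrightarrow> s \<le> b \<Longrightarrow> s - t \<le> d \<Longrightarrow>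
      (\<lambda>j. ((s - t) ^ j / fact j) *\<^sub>R g (k + j) t) sums g k s"
    and init: "\<And>k. f k 0 = g k 0"
    and s: "0 \<le> s" "s \<le> b"
  shows "f k s = g k s"
proof -
  have "s \<le> real N * d \<Longrightarrow> 0 \<le> s \<Longrightarrow> s \<le> b \<Longrightarrow> f k s = g k s" for N s k
  proof (induction N arbitrary: s k)
    case 0
    then show ?case using init by simp
  next
    case (Suc N)
    define t where "t = max 0 (s - d)"
    have "t \<le> real N * d"
      using Suc.prems d by (auto simp: t_def algebra_simps)
    moreover have t: "0 \<le> t" "t \<le> s" "s - t \<le> d"
      using Suc.prems d by (auto simp: t_def)
    ultimately have "f j t = g j t" for j
      using Suc.IH Suc.prems by auto
    then show ?case
      using f[OF t(1,2) Suc.prems(3) t(3), of k] g[OF t(1,2) Suc.prems(3) t(3), of k]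
      by (simp add: sums_iff)
  qed
  moreover obtain N where "s \<le> real N * d"
    using reals_Archimedean3[OF d] less_imp_le by blast
  ultimately show ?thesis using s by blast
qed

context symmetric_power_series
begin

lemma taylor_sums:
  assumes "norm h \<le> \<beta>" "\<beta> > 0" "(norm a + \<beta>) * K < 1"
  shows "taylor_term n a h v sums D n (a + h) v"
  using taylor[OF assms(2,3), of n] assms(1) by blast

text \<open>
  The Taylor series at \<open>a\<close> may converge beyond the ball where its sum is known. On the segment
  from \<open>a\<close> to \<open>x\<close>, its restriction is a power series on the real line, and comparing all
  derivatives in small steps shows that the two functions agree on the half-open segment; uniform
  convergence then gives the endpoint.
\<close>
lemma sums_D_of_uconv:
  assumes a: "norm a * K < 1" and x: "norm x * K < 1" and xs: "x \<in> cball a s"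
    and uc: "uconv n (cball a s) (tterm (\<lambda>k. D (n + k)) a)"
  shows "(\<lambda>m. tterm (\<lambda>k. D (n + k)) a m x v) sums D n x v"
proof -
  \<comment> \<open>On the segment, the \<open>k\<close>-th Taylor term at
    \<open>a + t *\<^sub>R h\<close> is \<open>t ^ k *\<^sub>R c k\<close>.\<close>
  define h where "h = x - a"
  define c where "c = taylor_term n a h v"
  have bml_term: "bml n (\<lambda>v. taylor_term n a y v k)" for y k
    by (intro bml_scaleR bml_prepend_right) (use bml_D[OF a, of "n + k"] in \<open>simp add: add.commute\<close>)
  obtain Gl where Gl: "\<And>y. y \<in> cball a s \<Longrightarrow> bml n (Gl y)"
    and conv: "\<And>\<epsilon>. \<epsilon> > 0 \<Longrightarrow> \<exists>N. \<forall>M\<ge>N. \<forall>y\<in>cball a s.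
      mnorm n (\<lambda>v. (\<Sum>m<M. tterm (\<lambda>k. D (n + k)) a m y v) - Gl y v) < \<epsilon>"
    using uc unfolding uconv_def by blast
  define S where "S t = Gl (a + t *\<^sub>R h) v" for t
  have seg: "a + t *\<^sub>R h \<in> cball a s" if "t \<in> {0..1}" for t
  proof -
    have "\<bar>t\<bar> * norm h \<le> 1 * norm h"
      using that by (intro mult_right_mono) auto
    then show ?thesis
      using xs by (simp add: dist_norm h_def norm_minus_commute)
  qed
  have term_scale: "taylor_term n a (t *\<^sub>R h) v k = t ^ k *\<^sub>R c k" for t k
  proof -
    have "bml (k + n) (D (n + k) a)"
      using bml_D[OF a, of "n + k"] by (simp add: add.commute)
    then show ?thesis
      by (simp add: c_def bml_reps_scale)
  qed
  let ?P = "\<Prod>i<n. norm (v i)"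
  have unif: "uniform_limit {0..1} (\<lambda>M t. \<Sum>k<M. t ^ k *\<^sub>R c k) S sequentially"
  proof (rule uniform_limitI)
    fix \<epsilon> :: real assume \<epsilon>: "\<epsilon> > 0"
    have P: "?P \<ge> 0"
      by (simp add: prod_nonneg)
    \<comment> \<open>The added 1 guards against a vanishing product \<open>?P\<close>.\<close>
    have "\<epsilon> / (?P + 1) > 0"
      using \<epsilon> P by simp
    from conv[OF this] obtain N where N: "\<And>M y. M \<ge> N \<Longrightarrow> y \<in> cball a s \<Longrightarrow>
        mnorm n (\<lambda>v. (\<Sum>m<M. tterm (\<lambda>k. D (n + k)) a m y v) - Gl y v) < \<epsilon> / (?P + 1)"
      by blast
    have "dist (\<Sum>k<M. t ^ k *\<^sub>R c k) (S t) < \<epsilon>" if M: "M \<ge> N" and t: "t \<in> {0..1}" for M t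
    proof -
      let ?T = "\<lambda>v. (\<Sum>m<M. tterm (\<lambda>k. D (n + k)) a m (a + t *\<^sub>R h) v) - Gl (a + t *\<^sub>R h) v"
      have "bml n ?T"
        unfolding tterm_D by (intro bml_diff bml_sum bml_term Gl seg t)
      then have "norm (?T v) \<le> mnorm n ?T * ?P"
        by (rule norm_le_mnorm)
      also have "\<dots> \<le> \<epsilon> / (?P + 1) * ?P"
        using N[OF M seg[OF t]] P by (intro mult_right_mono) auto
      also have "\<dots> < \<epsilon>"
        using \<epsilon> P by (simp add: field_simps)
      finally show ?thesis
        unfolding tterm_D by (simp add: term_scale dist_norm S_def)
    qed
    then show "\<forall>\<^sub>F M in sequentially. \<forall>t\<in>{0..1}. dist (\<Sum>k<M. t ^ k *\<^sub>R c k) (S t) < \<epsilon>"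
      unfolding eventually_sequentially by blast
  qed
  have c_sums: "(\<lambda>k. t ^ k *\<^sub>R c k) sums S t" if "t \<in> {0..1}" for t
    unfolding sums_def by (rule tendsto_uniform_limitI[OF unif that])
  have "continuous_on {0..1} S"
    by (rule uniform_limit_theorem[OF _ unif]) (auto intro!: always_eventually continuous_intros)
  then have S_lim: "(S \<longlongrightarrow> S 1) (at_left 1)"
    by (rule continuous_on_Icc_at_leftD) simp
  have "c sums S 1"
    using c_sums[of 1] by simp
  \<comment> \<open>Convergence at \<open>t = 1\<close> already bounds the coefficients, so the
    series on the line can be re-expanded at every point of \<open>[0, 1)\<close>.\<close>
  then have "Bseq c"
    by (intro convergent_imp_Bseq) (auto dest!: sums_summable summable_LIMSEQ_zero intro: convergentI)
  then obtain M where M: "\<And>k. norm (c k) \<le> M"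
    unfolding Bseq_def by blast
  define L' where "L' k w = (\<Prod>i<k. w i :: real) *\<^sub>R c k" for k w
  interpret line: symmetric_power_series L' "\<lambda>_. M" 1
    unfolding L'_def[abs_def] by (rule symmetric_power_series_real[OF M])
  \<comment> \<open>\<open>f k\<close> and \<open>g k\<close> are the \<open>k\<close>-th
    derivatives in \<open>t\<close> of the sum on the line and of
    \<open>D n (a + t *\<^sub>R h) v\<close>.\<close>
  define f where "f k t = line.D k t (\<lambda>_. 1)" for k t
  define g where "g k t = D (n + k) (a + t *\<^sub>R h) (reps k h v)" for k t
  \<comment> \<open>The endpoint of larger norm; by convexity it bounds the norm on the whole
    segment, so one \<open>\<delta>\<close> works at every point.\<close>
  define z where "z = (if norm a \<le> norm x then x else a)"
  have z: "norm z * K < 1"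
    using a x by (simp add: z_def)
  have le_z: "norm (a + t *\<^sub>R h) \<le> norm z" if "0 \<le> t" "t \<le> 1" for t
  proof -
    have "a + t *\<^sub>R h = (1 - t) *\<^sub>R a + t *\<^sub>R x"
      by (simp add: h_def algebra_simps)
    then have "norm (a + t *\<^sub>R h) \<le> (1 - t) * norm a + t * norm x"
      using that norm_triangle_ineq[of "(1 - t) *\<^sub>R a" "t *\<^sub>R x"] by simp
    also have "\<dots> \<le> (1 - t) * norm z + t * norm z"
      using that by (intro add_mono mult_left_mono) (auto simp: z_def)
    finally show ?thesis by (simp add: algebra_simps)
  qed
  obtain \<delta> where \<delta>: "\<delta> > 0" "(norm z + \<delta>) * K < 1"
    using exists_taylor_radius[OF z] .
  have agree: "S b = D n (a + b *\<^sub>R h) v" if b: "0 \<le> b" "b < 1" for b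
  proof -
    \<comment> \<open>The first bound keeps \<open>(s - t) *\<^sub>R h\<close> within
      \<open>\<delta>\<close>. The second keeps each expansion on the line inside the unit interval,
      as \<open>b + (1 - b) / 2 < 1\<close>.\<close>
    define d where "d = min (\<delta> / (norm h + 1)) ((1 - b) / 2)"
    have nh: "norm h + 1 > 0"
      using norm_ge_zero[of h] by linarith
    have d: "d > 0" "d \<le> \<delta> / (norm h + 1)" "d \<le> (1 - b) / 2"
      unfolding d_def by (use \<delta>(1) b nh in simp) (rule min.cobounded1 min.cobounded2)+
    have "f 0 b = g 0 b"
    proof (rule taylor_stepping_unique[OF d(1), where b = b])
      fix k and t s :: real assume t: "0 \<le> t" "t \<le> s" "s \<le> b" "s - t \<le> d"
      have "line.taylor_term k t (s - t) (\<lambda>_. 1) sums line.D k (t + (s - t)) (\<lambda>_. 1)"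
        by (rule line.taylor_sums[where \<beta> = "(1 - b) / 2"]) (use t d b in \<open>auto simp: field_simps\<close>)
      moreover have "line.taylor_term k t (s - t) (\<lambda>_. 1) j = ((s - t) ^ j / fact j) *\<^sub>R f (k + j) t" for j
      proof -
        have "bml (j + k) (line.D (k + j) t)"
          using line.bml_D[of t "k + j"] t b by (simp add: add.commute)
        from bml_reps_scale[OF this, of "s - t" 1 "\<lambda>_. 1"] show ?thesis
          by (simp add: f_def reps_same)
      qed
      ultimately show "(\<lambda>j. ((s - t) ^ j / fact j) *\<^sub>R f (k + j) t) sums f k s"
        by (simp add: f_def)
      have t1: "t \<le> 1"
        using t b by simp
      have "(norm (a + t *\<^sub>R h) + \<delta>) * K < 1"
        using le_z[OF t(1) t1] \<delta>(2) K_pos by (meson add_right_mono le_less_trans mult_right_mono less_imp_le)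
      moreover have "norm ((s - t) *\<^sub>R h) \<le> \<delta>"
      proof -
        have "norm ((s - t) *\<^sub>R h) = (s - t) * norm h"
          using t(2) by simp
        also have "\<dots> \<le> (\<delta> / (norm h + 1)) * norm h"
          using order_trans[OF t(4) d(2)] by (rule mult_right_mono) simp
        also have "\<dots> \<le> \<delta>"
          using \<delta>(1) nh by (simp add: field_simps)
        finally show ?thesis .
      qed
      ultimately have "taylor_term (n + k) (a + t *\<^sub>R h) ((s - t) *\<^sub>R h) (reps k h v)
          sums D (n + k) (a + t *\<^sub>R h + (s - t) *\<^sub>R h) (reps k h v)"
        using \<delta>(1) by (intro taylor_sums)
      moreover have "a + t *\<^sub>R h + (s - t) *\<^sub>R h = a + s *\<^sub>R h"
        by (simp add: algebra_simps)
      moreover have "taylor_term (n + k) (a + t *\<^sub>R h) ((s - t) *\<^sub>R h) (reps k h v) j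
          = ((s - t) ^ j / fact j) *\<^sub>R g (k + j) t" for j
      proof -
        have "norm (a + t *\<^sub>R h) * K < 1"
          using le_z[OF t(1) t1] z K_pos by (meson le_less_trans mult_right_mono less_imp_le)
        then have "bml (j + (n + k)) (D (n + k + j) (a + t *\<^sub>R h))"
          using bml_D[of "a + t *\<^sub>R h" "n + k + j"] by (simp add: add_ac)
        then show ?thesis
          by (simp add: bml_reps_scale g_def reps_reps add_ac)
      qed
      ultimately show "(\<lambda>j. ((s - t) ^ j / fact j) *\<^sub>R g (k + j) t) sums g k s"
        by (simp add: g_def)
    next
      fix k
      show "f k 0 = g k 0"
        by (simp add: f_def g_def deriv_series_0[of L', OF line.L_bml] L'_def c_def)
    qed (use b in auto)
    moreover have "f 0 b = S b"
    proof -
      have "prod (reps m b (\<lambda>_. 1)) {..<m} = (\<Prod>i<m. b)" for m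
        by (rule prod.cong) (auto simp: prepend_def)
      then show ?thesis
        using c_sums[of b] b by (simp add: f_def deriv_series_def L'_def sums_iff)
    qed
    ultimately show ?thesis
      by (simp add: g_def)
  qed
  have "((\<lambda>t. D n (a + t *\<^sub>R h) v) \<longlongrightarrow> D n x v) (at_left 1)"
  proof -
    obtain \<eta> M' where \<eta>: "\<eta> > 0" "M' \<ge> 0" and rem: "\<And>y v. norm y \<le> \<eta> \<Longrightarrow>
        norm (D n (x + y) v - (\<Sum>k<1. taylor_term n x y v k)) \<le> M' * norm y ^ 1 * (\<Prod>i<n. norm (v i))"
      using taylor_remainder[OF x, of n 1] by blast
    have "((\<lambda>t. (t - 1) *\<^sub>R h) \<longlongrightarrow> (1 - 1) *\<^sub>R h) (at_left 1)"
      by (intro tendsto_intros)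
    then have y_lim: "((\<lambda>t. (t - 1) *\<^sub>R h) \<longlongrightarrow> 0) (at_left 1)"
      by simp
    then have "\<forall>\<^sub>F t in at_left 1. norm ((t - 1) *\<^sub>R h) < \<eta>"
      using \<eta>(1) by (intro order_tendstoD(2)[OF tendsto_norm_zero])
    then have "\<forall>\<^sub>F t in at_left 1. norm (D n (a + t *\<^sub>R h) v - D n x v) \<le> M' * norm ((t - 1) *\<^sub>R h) * ?P"
    proof (rule eventually_mono)
      fix t assume "norm ((t - 1) *\<^sub>R h) < \<eta>"
      moreover have "x + (t - 1) *\<^sub>R h = a + t *\<^sub>R h"
        by (simp add: h_def algebra_simps)
      ultimately show "norm (D n (a + t *\<^sub>R h) v - D n x v) \<le> M' * norm ((t - 1) *\<^sub>R h) * ?P"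
        using rem[of "(t - 1) *\<^sub>R h" v] by simp
    qed
    moreover have "((\<lambda>t. M' * norm ((t - 1) *\<^sub>R h) * ?P) \<longlongrightarrow> 0) (at_left 1)"
      by (intro tendsto_mult_left_zero tendsto_mult_right_zero tendsto_norm_zero y_lim)
    ultimately have "((\<lambda>t. D n (a + t *\<^sub>R h) v - D n x v) \<longlongrightarrow> 0) (at_left 1)"
      by (rule Lim_null_comparison)
    then show ?thesis
      by (simp add: LIM_zero_iff)
  qed
  moreover have "\<forall>\<^sub>F t in at_left (1::real). D n (a + t *\<^sub>R h) v = S t"
    unfolding eventually_at_left_field using agree by (intro exI[of _ 0]) auto
  ultimately have "(S \<longlongrightarrow> D n x v) (at_left 1)"
    by (rule Lim_transform_eventually)
  then have "S 1 = D n x v"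
    using S_lim by (intro tendsto_unique[of "at_left (1::real)"]) auto
  with \<open>c sums S 1\<close> show ?thesis
    unfolding tterm_D by (simp add: c_def h_def)
qed

end

subsection \<open>Radius of analyticity\<close>

text \<open>The point of the closed ball farthest out lies in direction \<open>a\<close> and has
  norm \<open>norm a + r\<close>. In the zero space no such direction exists and \<open>r\<close>
  may exceed \<open>R\<close>, so the same ball is described with radius 0.\<close>

lemma cball_subset_ball_cases:
  fixes a :: "'a::real_normed_vector"
  assumes sub: "cball a r \<subseteq> ball 0 R" and r: "0 \<le> r"
  obtains s where "cball a r = cball a s" "0 \<le> s" "norm a + s < R"
proof (cases "\<exists>y::'a. y \<noteq> 0")
  case True
  then obtain y :: 'a where y: "y \<noteq> 0" by blast
  define u where "u = (if a = 0 then y /\<^sub>R norm y else a /\<^sub>R norm a)"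
  have u: "norm u = 1" "a = norm a *\<^sub>R u"
    using y by (auto simp: u_def)
  have "a + r *\<^sub>R u \<in> cball a r"
    using r u(1) by (simp add: dist_norm)
  then have "norm (a + r *\<^sub>R u) < R"
    using sub by (auto simp: subset_iff)
  moreover have "a + r *\<^sub>R u = (norm a + r) *\<^sub>R u"
    using u(2) by (simp add: scaleR_add_left)
  ultimately show ?thesis
    using r u(1) by (intro that[of r]) auto
next
  case False
  then have "x = a" for x
    by metis
  then have "cball a r = cball a 0"
    using r by auto
  moreover have "norm a < R"
    using sub r by (auto simp: subset_iff)
  ultimately show ?thesis
    by (intro that[of 0]) auto
qed

text \<open>Equality \<open>R * K = 1\<close> is allowed: points of the open ball, and closed balls
  inside it, still satisfy the strict inequalities.\<close>

lemma (in symmetric_power_series) fully_analytic_D: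
  assumes R: "R * K \<le> 1"
  shows "fully_analytic n (ball 0 R) (D n)"
  unfolding fully_analytic_def
proof (intro exI[of _ "\<lambda>k. D (n + k)"] conjI ballI allI impI)
  have in_dom: "norm x * K < 1" if "norm x < R" for x
    using mult_strict_right_mono[OF that K_pos] R by linarith
  show "dtower n (ball 0 R) (D n) (\<lambda>k. D (n + k))"
    by (rule dtower_D) (auto intro: in_dom)
  fix a :: 'a assume "a \<in> ball 0 R"
  then have a: "norm a * K < 1"
    by (intro in_dom) simp
  show "urad n a (tterm (\<lambda>k. D (n + k)) a) > 0"
  proof -
    obtain \<delta> where \<delta>: "\<delta> > 0" "(norm a + \<delta>) * K < 1"
      using exists_taylor_radius[OF a] .
    have "ereal \<delta> \<le> urad n a (tterm (\<lambda>k. D (n + k)) a)"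
      unfolding urad_def using uconv_tterm_D[of \<delta> a n] \<delta> by (intro Sup_upper) auto
    then show ?thesis
      using \<delta>(1) by (auto intro: less_le_trans[rotated])
  qed
  show "(\<lambda>m. tterm (\<lambda>k. D (n + k)) a m x v) sums D n x v"
    if x: "x \<in> udom n a (tterm (\<lambda>k. D (n + k)) a) \<inter> ball 0 R" for x v
  proof -
    obtain s where "x \<in> cball a s" "uconv n (cball a s) (tterm (\<lambda>k. D (n + k)) a)"
      using x unfolding udom_def by auto
    moreover have "norm x * K < 1"
      using x by (intro in_dom) simp
    ultimately show ?thesis
      using a by (intro sums_D_of_uconv)
  qed
  fix r assume sub: "cball a r \<subseteq> ball 0 R"
  show "uconv n (cball a r) (tterm (\<lambda>k. D (n + k)) a)"
  proof (cases "r < 0")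
    case True
    then show ?thesis by (simp add: uconv_def)
  next
    case False
    then obtain s where s: "cball a r = cball a s" "0 \<le> s" "norm a + s < R"
      using cball_subset_ball_cases[OF sub] by auto
    have "(norm a + s) * K < 1"
      using mult_strict_right_mono[OF s(3) K_pos] R by linarith
    then show ?thesis
      unfolding s(1) by (rule uconv_tterm_D[OF s(2)])
  qed
qed

section \<open>From uniform convergence to bounds on the coefficients\<close>

text \<open>Late terms are differences of two partial sums within 1 of the limit, hence at most 2 on
  the ball; the finitely many early ones are bounded individually. Homogeneity extends the bounds to
  all \<open>x\<close>.\<close>

lemma uconv_imp_polynomial_bound:
  fixes L :: "nat \<Rightarrow> (nat \<Rightarrow> 'a::real_normed_vector) \<Rightarrow> 'b::real_normed_vector"
  assumes L: "\<And>m. bml m (L m)" and r: "r > 0"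
    and uc: "uconv 0 (cball 0 r) (\<lambda>m x v. L m (\<lambda>_. x))"
  obtains B where "B \<ge> 0" "\<And>m x. norm (L m (\<lambda>_. x)) \<le> B * (norm x / r) ^ m"
proof -
  have const: "bml 0 (\<lambda>v :: nat \<Rightarrow> 'a. y)" for y :: 'b
    by (rule bmlI[where C = "norm y"]) auto
  obtain Gl :: "'a \<Rightarrow> (nat \<Rightarrow> 'a) \<Rightarrow> 'b" where Gl: "\<And>x. x \<in> cball 0 r \<Longrightarrow> bml 0 (Gl x)"
    and conv: "\<And>\<epsilon>. \<epsilon> > 0 \<Longrightarrow> \<exists>N. \<forall>M\<ge>N. \<forall>x\<in>cball 0 r.
      mnorm 0 (\<lambda>v. (\<Sum>m<M. L m (\<lambda>_. x)) - Gl x v) < \<epsilon>"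
    using uc unfolding uconv_def by blast
  obtain N where N: "\<And>M x. M \<ge> N \<Longrightarrow> x \<in> cball 0 r \<Longrightarrow>
      mnorm 0 (\<lambda>v. (\<Sum>m<M. L m (\<lambda>_. x)) - Gl x v) < 1"
    using conv[OF zero_less_one] by blast
  have close: "norm ((\<Sum>m<M. L m (\<lambda>_. x)) - Gl x v) < 1" if "M \<ge> N" "x \<in> cball 0 r" for M x v
    using norm_le_mnorm[OF bml_diff[OF const Gl[OF that(2)]], of "\<Sum>m<M. L m (\<lambda>_. x)" v] N[OF that]
    by simp
  have ball: "norm (L m (\<lambda>_. y)) \<le> 2" if "m \<ge> N" "norm y \<le> r" for m y
  proof -
    have "L m (\<lambda>_. y) = ((\<Sum>j<Suc m. L j (\<lambda>_. y)) - Gl y (\<lambda>_. 0)) - ((\<Sum>j<m. L j (\<lambda>_. y)) - Gl y (\<lambda>_. 0))"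
      by simp
    then show ?thesis
      using norm_triangle_ineq4 close[of "Suc m" y "\<lambda>_. 0"] close[of m y "\<lambda>_. 0"] that
      by (smt (verit) le_SucI mem_cball_0)
  qed
  have "\<forall>m. \<exists>c. c \<ge> 0 \<and> (\<forall>x. norm (L m (\<lambda>_. x)) \<le> c * norm x ^ m)"
  proof
    fix m
    obtain c where c: "c \<ge> 0" "\<And>v. norm (L m v) \<le> c * (\<Prod>i<m. norm (v i))"
      using bml_bound[OF L] by blast
    show "\<exists>c. c \<ge> 0 \<and> (\<forall>x. norm (L m (\<lambda>_. x)) \<le> c * norm x ^ m)"
      using c(1) c(2)[of "\<lambda>_. _"] by (intro exI[of _ c]) simp
  qed
  then obtain c where c: "\<And>m. c m \<ge> 0" "\<And>m x. norm (L m (\<lambda>_. x)) \<le> c m * norm x ^ m"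
    by metis
  define B where "B = 2 + (\<Sum>m<N. c m * r ^ m)"
  have S0: "(\<Sum>m<N. c m * r ^ m) \<ge> 0"
    using c(1) r by (intro sum_nonneg) auto
  show thesis
  proof (rule that[of B])
    show "B \<ge> 0"
      using S0 by (simp add: B_def)
    fix m and x :: 'a
    have q: "(norm x / r) ^ m \<ge> 0"
      using r by simp
    show "norm (L m (\<lambda>_. x)) \<le> B * (norm x / r) ^ m"
    proof (cases "m < N")
      case True
      have "norm (L m (\<lambda>_. x)) \<le> (c m * r ^ m) * (norm x / r) ^ m"
        using c(2)[of m x] r by (simp add: power_divide)
      also have "c m * r ^ m \<le> (\<Sum>m<N. c m * r ^ m)"
        using True c(1) r by (intro member_le_sum) auto
      also have "\<dots> \<le> B"
        by (simp add: B_def)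
      finally show ?thesis
        using q by (simp add: mult_right_mono)
    next
      case False
      define y where "y = (r / norm x) *\<^sub>R x"
      have "x = (norm x / r) *\<^sub>R y" "norm y \<le> r"
        using r by (auto simp: y_def)
      then have "norm (L m (\<lambda>_. x)) = (norm x / r) ^ m * norm (L m (\<lambda>_. y))"
        using bml_scale[OF L, of m "\<lambda>_. norm x / r" "\<lambda>_. y"] r by simp
      also have "\<dots> \<le> (norm x / r) ^ m * B"
        using ball[of m y] \<open>norm y \<le> r\<close> False S0 q by (intro mult_left_mono) (auto simp: B_def)
      finally show ?thesis by (simp add: mult.commute)
    qed
  qed
qed

text \<open>
  The \<open>n\<close> trailing slots cost only a factor \<open>sqrt (1 + \<epsilon>\<^sup>2) ^ n\<close> in the exponential growth rate,
  which is absorbed by the strict inequality between \<open>sqrt 2\<close> and \<open>K * r\<close>.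
\<close>
lemma symmetric_power_series_exists:
  fixes L :: "nat \<Rightarrow> (nat \<Rightarrow> 'a::real_normed_vector) \<Rightarrow> 'b::banach"
  assumes L: "\<And>m. bml m (L m)" "\<And>m. msym m (L m)" and B: "B \<ge> 0"
    and r: "r > 0" and bound: "\<And>m x. norm (L m (\<lambda>_. x)) \<le> B * (norm x / r) ^ m"
    and K: "sqrt 2 < K * r"
  obtains C where "symmetric_power_series L C K"
proof -
  have Kr: "K * r > 0"
    using K real_sqrt_gt_zero[of 2] by linarith
  then have K0: "K > 0"
    using r by (simp add: zero_less_mult_iff)
  \<comment> \<open>The left side tends to \<open>sqrt 2\<close> as \<open>\<epsilon>\<close> tends
    to 0, for each fixed \<open>n\<close>.\<close>
  have "\<exists>\<epsilon>>0. sqrt 2 * sqrt (1 + \<epsilon>\<^sup>2) ^ n < K * r" for n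
  proof -
    have "((\<lambda>\<epsilon>::real. sqrt 2 * sqrt (1 + \<epsilon>\<^sup>2) ^ n) \<longlongrightarrow> sqrt 2 * sqrt (1 + 0\<^sup>2) ^ n) (at_right 0)"
      by (intro tendsto_intros)
    then have "\<forall>\<^sub>F \<epsilon> in at_right 0. sqrt 2 * sqrt (1 + \<epsilon>\<^sup>2) ^ n < K * r"
      using K by (intro order_tendstoD(2)) auto
    moreover have "\<forall>\<^sub>F \<epsilon> in at_right (0::real). \<epsilon> > 0"
      by (rule eventually_at_right_less)
    ultimately have "\<forall>\<^sub>F \<epsilon> in at_right 0. \<epsilon> > 0 \<and> sqrt 2 * sqrt (1 + \<epsilon>\<^sup>2) ^ n < K * r"
      by eventually_elim simp
    then show ?thesis
      using eventually_happens trivial_limit_at_right_real by blast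
  qed
  then obtain \<epsilon> where \<epsilon>: "\<And>n. \<epsilon> n > 0" "\<And>n. sqrt 2 * sqrt (1 + (\<epsilon> n)\<^sup>2) ^ n < K * r"
    by metis
  have "symmetric_power_series L (\<lambda>n. B / \<epsilon> n ^ n) K"
  proof
    show "0 \<le> B / \<epsilon> n ^ n" for n
      using B \<epsilon>(1)[of n] by simp
    fix m k n and a h :: 'a and v :: "nat \<Rightarrow> 'a"
    let ?N = "m + k + n" and ?q = "sqrt (1 + (\<epsilon> n)\<^sup>2)"
    let ?X = "(norm a ^ m * norm h ^ k) * (\<Prod>i<n. norm (v i))"
    have X: "?X \<ge> 0"
      by (simp add: prod_nonneg)
    have "norm (L ?N (reps m a (reps k h v)))
        \<le> B / r ^ ?N * (?q ^ ?N / \<epsilon> n) ^ n * sqrt 2 ^ (m + k) * (norm a ^ m * norm h ^ k)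
          * (\<Prod>i<n. norm (v i))"
    proof (rule symmetric_bml_reps_reps_bound[OF \<epsilon>(1) _ L])
      show "norm (L ?N (\<lambda>_. x)) \<le> B / r ^ ?N * norm x ^ ?N" for x
        using bound[of ?N x] by (simp add: power_divide)
    qed (use B r in simp)
    \<comment> \<open>Raising the exponent of \<open>sqrt 2\<close> to \<open>?N\<close> lets all
      growth be collected in one \<open>?N\<close>-th power.\<close>
    also have "\<dots> \<le> B / r ^ ?N * (?q ^ ?N / \<epsilon> n) ^ n * sqrt 2 ^ ?N * ?X"
      using B r \<epsilon>(1)[of n] X unfolding mult.assoc
      by (intro mult_left_mono mult_right_mono power_increasing) (auto simp: mult.assoc)
    also have "\<dots> = B / \<epsilon> n ^ n * (sqrt 2 * ?q ^ n / r) ^ ?N * ?X"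
      by (simp add: power_divide power_mult_distrib mult_ac flip: power_mult)
    also have "\<dots> \<le> B / \<epsilon> n ^ n * K ^ ?N * ?X"
    proof (intro mult_right_mono mult_left_mono power_mono X)
      show "sqrt 2 * ?q ^ n / r \<le> K"
        using \<epsilon>(2)[of n] r by (simp add: divide_le_eq)
    qed (use B r \<epsilon>(1)[of n] in auto)
    finally show "norm (L ?N (reps m a (reps k h v)))
        \<le> B / \<epsilon> n ^ n * K ^ ?N * (norm a ^ m * norm h ^ k) * (\<Prod>i<n. norm (v i))"
      by (simp add: mult.assoc)
  qed (use L K0 in auto)
  then show thesis by (rule that)
qed

theorem mainTheorem7:
  fixes L :: "nat \<Rightarrow> (nat \<Rightarrow> 'a::banach) \<Rightarrow> 'b::banach"
  assumes Lml: "\<And>m. bml m (L m) \<and> msym m (L m)"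
    and rpos: "urad 0 0 (\<lambda>m x v. L m (\<lambda>_. x)) > 0"
  shows
    "arad 0 0 (\<lambda>x v. \<Sum>m. L m (\<lambda>_. x)) \<ge> urad 0 0 (\<lambda>m x v. L m (\<lambda>_. x)) / ereal (sqrt 2)
     \<and> (\<exists>e>0. \<exists>D. dtower 0 (ball 0 e) (\<lambda>x v. \<Sum>m. L m (\<lambda>_. x)) D \<and>
          (\<forall>n\<ge>1. (\<forall>m x. tterm (\<lambda>k. D (n + k)) 0 m x =
                  (\<lambda>v. (fact n * real ((m + n) choose n)) *\<^sub>R L (m + n) (\<lambda>i. if i < m then x else v (i - m))))
               \<and> (n = 2 \<longrightarrow> urad n 0 (tterm (\<lambda>k. D (n + k)) 0)
                      \<ge> urad 0 0 (\<lambda>m x v. L m (\<lambda>_. x)) / ereal (sqrt 2))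
               \<and> (n \<ge> 3 \<longrightarrow> urad n 0 (tterm (\<lambda>k. D (n + k)) 0)
                      \<ge> urad 0 0 (\<lambda>m x v. L m (\<lambda>_. x)) / ereal (sqrt (exp 1)))))
     \<and> (\<forall>n. arad n 0 (\<lambda>x v. \<Sum>m. (fact n * real ((m + n) choose n)) *\<^sub>R
                              L (m + n) (\<lambda>i. if i < m then x else v (i - m)))
              \<ge> urad 0 0 (\<lambda>m x v. L m (\<lambda>_. x)) / ereal (sqrt 2))"
proof -
  define \<rho> where "\<rho> = urad 0 0 (\<lambda>m x v. L m (\<lambda>_. x))"
  let ?D = "deriv_series L"
  have L: "bml m (L m)" "msym m (L m)" for m
    using Lml by auto
  have \<rho>: "0 < \<rho> / ereal (sqrt 2)"
    using rpos by (simp add: \<rho>_def ereal_less_divide_iff)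
  \<comment> \<open>The definition of \<open>\<rho>\<close> as a supremum supplies a radius
    \<open>r > R * sqrt 2\<close> of uniform convergence, which is the strict inequality needed for
    \<open>K = 1 / R\<close>.\<close>
  have series: "\<exists>C. symmetric_power_series L C (1 / R)" if R: "R > 0" "ereal R < \<rho> / ereal (sqrt 2)" for R
  proof -
    have "ereal (R * sqrt 2) < \<rho>"
      using R by (simp add: ereal_less_divide_iff)
    then obtain r where r: "R * sqrt 2 < r" and uc: "uconv 0 (cball 0 r) (\<lambda>m x v. L m (\<lambda>_. x))"
      unfolding \<rho>_def urad_def by (auto simp: less_Sup_iff)
    have r0: "r > 0"
      using R(1) by (intro le_less_trans[OF _ r]) simp
    obtain B where "B \<ge> 0" "\<And>m x. norm (L m (\<lambda>_. x)) \<le> B * (norm x / r) ^ m"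
      using uconv_imp_polynomial_bound[OF L(1) r0 uc] by blast
    moreover have "sqrt 2 < 1 / R * r"
      using r R(1) by (simp add: field_simps)
    ultimately show ?thesis
      using symmetric_power_series_exists[OF L _ r0] by metis
  qed
  \<comment> \<open>\<open>\<rho>\<close> may be infinite, so the bounds are tested on real radii
    below \<open>\<rho> / ereal (sqrt 2)\<close>.\<close>
  have le_from_reals: "\<rho> / ereal (sqrt 2) \<le> y"
    if "\<And>R. R > 0 \<Longrightarrow> ereal R < \<rho> / ereal (sqrt 2) \<Longrightarrow> ereal R \<le> y" for y
  proof (rule dense_le_bounded[OF \<rho>])
    fix w assume "0 < w" "w < \<rho> / ereal (sqrt 2)"
    then show "w \<le> y"
      using that by (cases w) auto
  qed
  have arad: "\<rho> / ereal (sqrt 2) \<le> arad n 0 (?D n)" for n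
  proof (rule le_from_reals)
    fix R :: real assume R: "R > 0" "ereal R < \<rho> / ereal (sqrt 2)"
    obtain C where "symmetric_power_series L C (1 / R)"
      using series[OF R] by blast
    then interpret symmetric_power_series L C "1 / R" .
    have "fully_analytic n (ball 0 R) (?D n)"
      using R(1) by (intro fully_analytic_D) simp
    then show "ereal R \<le> arad n 0 (?D n)"
      unfolding arad_def using R(1) by (intro Sup_upper) auto
  qed
  have urad: "\<rho> / ereal (sqrt 2) \<le> urad n 0 (tterm (\<lambda>k. ?D (n + k)) 0)" for n
  proof (rule le_from_reals)
    fix R :: real assume R: "R > 0" "ereal R < \<rho> / ereal (sqrt 2)"
    \<comment> \<open>A larger radius \<open>R'\<close> is inserted because uniform convergence on
      the closed ball of radius \<open>R\<close> requires \<open>R * (1 / R') < 1\<close>.\<close>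
    obtain z where z: "ereal R < z" "z < \<rho> / ereal (sqrt 2)"
      using dense[OF R(2)] by blast
    then obtain R' where R': "R < R'" "ereal R' < \<rho> / ereal (sqrt 2)"
      by (cases z) auto
    then obtain C where "symmetric_power_series L C (1 / R')"
      using series[of R'] R(1) by auto
    then interpret symmetric_power_series L C "1 / R'" .
    have "uconv n (cball 0 R) (tterm (\<lambda>k. ?D (n + k)) 0)"
      using R(1) R'(1) by (intro uconv_tterm_D) (auto simp: field_simps)
    then show "ereal R \<le> urad n 0 (tterm (\<lambda>k. ?D (n + k)) 0)"
      unfolding urad_def using R(1) by (intro Sup_upper) auto
  qed
  have sqrt_e: "\<rho> / ereal (sqrt (exp 1)) \<le> \<rho> / ereal (sqrt 2)"
  proof (rule ereal_divide_left_mono)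
    show "ereal (sqrt 2) \<le> ereal (sqrt (exp 1))"
      using exp_ge_add_one_self[of 1] by simp
  qed (use rpos in \<open>auto simp: \<rho>_def\<close>)
  have D0: "?D 0 = (\<lambda>x v. \<Sum>m. L m (\<lambda>_. x))"
  proof -
    have "L m (reps m x v) = L m (\<lambda>_. x)" for m x v
      by (rule bml_cong[OF L(1)]) (simp add: prepend_def)
    then show ?thesis
      by (auto simp: deriv_series_def fun_eq_iff)
  qed
  have tterm: "tterm (\<lambda>k. ?D (n + k)) 0 m x =
      (\<lambda>v. (fact n * real ((m + n) choose n)) *\<^sub>R L (m + n) (\<lambda>i. if i < m then x else v (i - m)))" for n m x
  proof
    fix v
    have "fact (n + m) / fact m = (fact n * real ((m + n) choose n))"
      by (simp add: binomial_fact field_simps add.commute)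
    then show "tterm (\<lambda>k. ?D (n + k)) 0 m x v =
        (fact n * real ((m + n) choose n)) *\<^sub>R L (m + n) (\<lambda>i. if i < m then x else v (i - m))"
      by (simp add: tterm_def deriv_series_0[OF L(1)] add.commute cong: if_cong)
  qed
  obtain w where w: "0 < w" "w < \<rho> / ereal (sqrt 2)"
    using dense[OF \<rho>] by blast
  then obtain e where e: "e > 0" "ereal e < \<rho> / ereal (sqrt 2)"
    by (cases w) auto
  have "dtower 0 (ball 0 e) (?D 0) ?D"
  proof -
    obtain C where "symmetric_power_series L C (1 / e)"
      using series[OF e] by blast
    then interpret symmetric_power_series L C "1 / e" .
    show ?thesis
      using dtower_D[of "ball 0 e" 0] e(1) by simp
  qed
  then have ii: "\<exists>e>0. \<exists>D. dtower 0 (ball 0 e) (\<lambda>x v. \<Sum>m. L m (\<lambda>_. x)) D \<and>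
          (\<forall>n\<ge>1. (\<forall>m x. tterm (\<lambda>k. D (n + k)) 0 m x =
                  (\<lambda>v. (fact n * real ((m + n) choose n)) *\<^sub>R L (m + n) (\<lambda>i. if i < m then x else v (i - m))))
               \<and> (n = 2 \<longrightarrow> urad n 0 (tterm (\<lambda>k. D (n + k)) 0) \<ge> \<rho> / ereal (sqrt 2))
               \<and> (n \<ge> 3 \<longrightarrow> urad n 0 (tterm (\<lambda>k. D (n + k)) 0) \<ge> \<rho> / ereal (sqrt (exp 1))))"
    using e(1) tterm urad order_trans[OF sqrt_e urad] unfolding D0
    by (intro exI[of _ e] conjI exI[of _ ?D]) blast+
  have iii: "\<rho> / ereal (sqrt 2) \<le> arad n 0 (\<lambda>x v. \<Sum>m. (fact n * real ((m + n) choose n)) *\<^sub>R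
      L (m + n) (\<lambda>i. if i < m then x else v (i - m)))" for n
    using arad[of n] unfolding deriv_series_def[abs_def] prepend_def .
  show ?thesis
    using arad[of 0] ii iii unfolding D0 \<rho>_def by blast
qed

end
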